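(* Let $\widehat{\Sigma}$ be an operator precedence alphabet with underlying finite alphabet $\Sigma$, and let $L\subseteq\Sigma^*$. Then $L$ is an operator precedence language over $\widehat{\Sigma}$ if and only if the syntactic congruence $\equiv_L$ has finitely many equivalence classes.
   Context: **Operator precedence alphabet.** $\widehat{\Sigma}$ is a finite alphabet $\Sigma$ together with three relations $\lessdot,\gtrdot,\doteq$ on $\Sigma$ such that for every ordered pair $(a,b)\in\Sigma^2$ exactly one of $a\lessdot b$, $a\gtrdot b$, $a\doteq b$ holds (no reflexivity, symmetry or transitivity is assumed). The relations are extended to the empty word $\varepsilon$ by $\varepsilon\lessdot a$, $a\gtrdot\varepsilon$ for all $a\in\Sigma$, and $\varepsilon\doteq\varepsilon$. For $w\in\Sigma^*$, $\mathrm{first}(w)$ and $\mathrm{last}(w)$ are its first and last letters, with $\mathrm{first}(\varepsilon)=\mathrm{last}(\varepsilon)=\varepsilon$. **Chains.** Chains with delimiters $a_0,a_{n+1}\in\Sigma\cup\{\varepsilon\}$ and body in $\Sigma^+$ are defined inductively. For $n\ge 1$ and $a_1,\dots,a_n\in\Sigma$ with $a_0\lessdot a_1\doteq a_2\doteq\cdots\doteq a_n\gtrdot a_{n+1}$, the word $a_0a_1\cdots a_na_{n+1}$ is a (simple) chain with delimiters $a_0,a_{n+1}$ and body $a_1\cdots a_n$. If moreover $u_0,\dots,u_n\in\Sigma^*$ are such that for each $0\le i\le n$ either $u_i=\varepsilon$ or $a_iu_ia_{i+1}$ is a chain with delimiters $a_i,a_{i+1}$ and body $u_i$, then $a_0u_0a_1u_1\cdots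 a_nu_na_{n+1}$ is a (composite) chain with delimiters $a_0,a_{n+1}$ and body $u_0a_1u_1\cdots a_nu_n$. For $x,y,z\in\Sigma^*$, write ${}^x[y]^z$ if $\mathrm{last}(x)\,y\,\mathrm{first}(z)$ is a chain with delimiters $\mathrm{last}(x),\mathrm{first}(z)$ and body $y$. **Collapsing.** $\lambda:\Sigma^*\to\Sigma^*$ is defined by $\lambda(w)=\lambda(xz)$ if $w=xyz$ with $x,y,z\in\Sigma^+$ and ${}^x[y]^z$, and $\lambda(w)=w$ if there is no such factorization (the result does not depend on the choices). Let $\Sigma^*_{\unlhd}$ (resp. $\Sigma^*_{\unrhd}$) be the set of $w\in\Sigma^*$ such that $|\lambda(w)|\le 1$ or $\lambda(w)=a_1\cdots a_n$ with, for every $1\le i<n$, $a_i\lessdot a_{i+1}$ or $a_i\doteq a_{i+1}$ (resp. $a_i\gtrdot a_{i+1}$ or $a_i\doteq a_{i+1}$). **Chain equivalence.** For $x,y\in\Sigma^*$, $x\approx y$ iff $\mathrm{first}(x)=\mathrm{first}(y)$, $\mathrm{last}(x)=\mathrm{last}(y)$, and for all $u,v,u_0,v_0\in\Sigma^*$ with $u_0\,\mathrm{first}(x)\in\Sigma^*_{\unrhd}$ and $\mathrm{last}(x)\,v_0\in\Sigma^*_{\unlhd}$: ${}^u[u_0xv_0]^v\Leftrightarrow{}^u[u_0yv_0]^v$. **Syntactic congruence.** For $L\subseteq\Sigma^*$, $x\equiv_L y$ iff $x\approx y$ and for all $u,v,u_0,v_0\in\Sigma^*$ with $u_0\,\mathrm{first}(x)\in\Sigma^*_{\unrhd}$,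 $\mathrm{last}(x)\,v_0\in\Sigma^*_{\unlhd}$ and ${}^u[u_0xv_0]^v$: $uu_0xv_0v\in L\Leftrightarrow uu_0yv_0v\in L$. This is an equivalence relation on $\Sigma^*$. **Operator precedence automata and languages.** An operator precedence automaton (OPA) over $\widehat{\Sigma}$ consists of a finite set of states $Q$, initial states $I\subseteq Q$, accepting states $F\subseteq Q$, and transition relations $\Delta_{\mathrm{push}},\Delta_{\mathrm{shift}}\subseteq Q\times\Sigma\times Q$, $\Delta_{\mathrm{pop}}\subseteq Q\times Q\times Q$. The stack alphabet is $\Gamma=\Sigma\times Q$; $\bot$ is the empty stack; the top is on the left. A configuration is $(s,w,\theta)$ with $s\in Q$, remaining input $w\in\Sigma^*$, and stack $\theta$. Let $a=\mathrm{first}(w)$. Steps are: - push: if $w=aw'$ with $a\in\Sigma$, and $\theta=\bot$ or the top of $\theta$ is $\langle a',q\rangle$ with $a'\lessdot a$, and $(s,a,t)\in\Delta_{\mathrm{push}}$, then $(s,w,\theta)\to(t,w',\langle a,s\rangle\theta)$; - shift: if $w=aw'$ with $a\in\Sigma$, $\theta=\langle a',q\rangle\theta'$, $a'\doteq a$, and $(s,a,t)\in\Delta_{\mathrm{shift}}$, then $(s,w,\theta)\to(t,w',\langle a,q\rangle\theta')$; - pop: if $\theta=\langle a',q\rangle\theta'$, $a'\gtrdot a$ (where $a=\varepsilon$ is allowed when $w=\varepsilon$), and $(s,q,t)\in\Delta_{\mathrm{pop}}$, then $(s,w,\theta)\to(t,w,\theta')$. The language of the OPA is the set of $w\in\Sigma^*$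 such that $(q_0,w,\bot)\to^*(q_F,\varepsilon,\bot)$ for some $q_0\in I$, $q_F\in F$. An operator precedence language over $\widehat{\Sigma}$ is a language recognized by some OPA over $\widehat{\Sigma}$. *)

theory Defs
  imports Main
begin

text \<open>
  Letters are the elements of a finite type, words are lists, and the empty word in the role of a
  letter (as a chain delimiter, or as the first or last letter of the empty word) is \<open>None\<close>.
\<close>

record ('a, 'q) opa =
  states :: "'q set"
  initial :: "'q set"
  accepting :: "'q set"
  push_trans :: "('q \<times> 'a \<times> 'q) set"
  shift_trans :: "('q \<times> 'a \<times> 'q) set"
  pop_trans :: "('q \<times> 'q \<times> 'q) set"

definition opa :: "('a, 'q) opa \<Rightarrow> bool" where
  "opa M \<longleftrightarrow>
     finite (states M) \<and> initial M \<subseteq> states M \<and> accepting M \<subseteq> states M \<and>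
     push_trans M \<subseteq> states M \<times> UNIV \<times> states M \<and>
     shift_trans M \<subseteq> states M \<times> UNIV \<times> states M \<and>
     pop_trans M \<subseteq> states M \<times> states M \<times> states M"

definition first_letter :: "'a list \<Rightarrow> 'a option" where
  "first_letter w = (if w = [] then None else Some (hd w))"

definition last_letter :: "'a list \<Rightarrow> 'a option" where
  "last_letter w = (if w = [] then None else Some (last w))"

primrec word_of :: "'a option \<Rightarrow> 'a list" where
  "word_of None = []"
| "word_of (Some a) = [a]"

text \<open>\<open>interleave [u\<^sub>0, \<dots>, u\<^sub>n] [a\<^sub>1, \<dots>, a\<^sub>n]\<close> is the word \<open>u\<^sub>0 a\<^sub>1 u\<^sub>1 \<dots> a\<^sub>n u\<^sub>n\<close>.\<close>

definition interleave :: "'a list list \<Rightarrow> 'a list \<Rightarrow> 'a list" where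
  "interleave us as = hd us @ concat (map2 (#) as (tl us))"

locale op_alphabet =
  fixes lt :: "'a::finite \<Rightarrow> 'a \<Rightarrow> bool"  (infix \<open>\<lhd>\<close> 50)
    and gt :: "'a \<Rightarrow> 'a \<Rightarrow> bool"  (infix \<open>\<rhd>\<close> 50)
    and eq :: "'a \<Rightarrow> 'a \<Rightarrow> bool"  (infix \<open>\<doteq>\<close> 50)
  assumes exactly_one:
    "(a \<lhd> b \<and> \<not> a \<rhd> b \<and> \<not> a \<doteq> b) \<or>
     (\<not> a \<lhd> b \<and> a \<rhd> b \<and> \<not> a \<doteq> b) \<or>
     (\<not> a \<lhd> b \<and> \<not> a \<rhd> b \<and> a \<doteq> b)"
begin

text \<open>
  The extension to the empty word. The relation \<open>\<doteq>\<close> is only ever needed between letters.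
\<close>

fun lt_ext :: "'a option \<Rightarrow> 'a option \<Rightarrow> bool"  (infix \<open>\<lhd>\<^sub>\<epsilon>\<close> 50) where
  "Some a \<lhd>\<^sub>\<epsilon> Some b \<longleftrightarrow> a \<lhd> b"
| "None \<lhd>\<^sub>\<epsilon> Some b \<longleftrightarrow> True"
| "_ \<lhd>\<^sub>\<epsilon> None \<longleftrightarrow> False"

fun gt_ext :: "'a option \<Rightarrow> 'a option \<Rightarrow> bool"  (infix \<open>\<rhd>\<^sub>\<epsilon>\<close> 50) where
  "Some a \<rhd>\<^sub>\<epsilon> Some b \<longleftrightarrow> a \<rhd> b"
| "Some a \<rhd>\<^sub>\<epsilon> None \<longleftrightarrow> True"
| "None \<rhd>\<^sub>\<epsilon> _ \<longleftrightarrow> False"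

text \<open>
  \<open>chain l y r\<close>: the word \<open>l y r\<close> is a chain with delimiters \<open>l\<close> and \<open>r\<close> and body \<open>y\<close>. With
  \<open>as = [a\<^sub>1, \<dots>, a\<^sub>n]\<close>, the list \<open>l # map Some as @ [r]\<close> consists of \<open>a\<^sub>0, \<dots>, a\<^sub>n\<^sub>+\<^sub>1\<close>; the simple chains
  are those for which every \<open>us ! i\<close> is empty.
\<close>

inductive chain :: "'a option \<Rightarrow> 'a list \<Rightarrow> 'a option \<Rightarrow> bool" where
  chainI:
  "\<lbrakk> as \<noteq> []; l \<lhd>\<^sub>\<epsilon> Some (hd as); successively (\<doteq>) as; Some (last as) \<rhd>\<^sub>\<epsilon> r;
     length us = Suc (length as);
     \<forall>i \<le> length as. us ! i = [] \<or>
       chain ((l # map Some as @ [r]) ! i) (us ! i) ((l # map Some as @ [r]) ! Suc i) \<rbrakk>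
   \<Longrightarrow> chain l (interleave us as) r"

definition chain_in :: "'a list \<Rightarrow> 'a list \<Rightarrow> 'a list \<Rightarrow> bool" where
  "chain_in x y z \<longleftrightarrow> chain (last_letter x) y (first_letter z)"

inductive collapse_step :: "'a list \<Rightarrow> 'a list \<Rightarrow> bool" where
  "\<lbrakk> x \<noteq> []; y \<noteq> []; z \<noteq> []; chain_in x y z \<rbrakk> \<Longrightarrow> collapse_step (x @ y @ z) (x @ z)"

text \<open>
  Collapsing shortens words and is confluent, so every word has exactly one irreducible collapse.
\<close>

definition collapse :: "'a list \<Rightarrow> 'a list" where
  "collapse w = (THE v. collapse_step\<^sup>*\<^sup>* w v \<and> \<not> (\<exists>v'. collapse_step v v'))"

definition lt_words :: "'a list set" where
  "lt_words = {w. length (collapse w) \<le> 1 \<or> successively (\<lambda>a b. a \<lhd> b \<or> a \<doteq> b) (collapse w)}"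

definition gt_words :: "'a list set" where
  "gt_words = {w. length (collapse w) \<le> 1 \<or> successively (\<lambda>a b. a \<rhd> b \<or> a \<doteq> b) (collapse w)}"

definition chain_equiv :: "'a list \<Rightarrow> 'a list \<Rightarrow> bool"  (infix \<open>\<approx>\<close> 50) where
  "x \<approx> y \<longleftrightarrow>
     first_letter x = first_letter y \<and> last_letter x = last_letter y \<and>
     (\<forall>u v u\<^sub>0 v\<^sub>0. u\<^sub>0 @ word_of (first_letter x) \<in> gt_words \<longrightarrow>
        word_of (last_letter x) @ v\<^sub>0 \<in> lt_words \<longrightarrow>
        (chain_in u (u\<^sub>0 @ x @ v\<^sub>0) v \<longleftrightarrow> chain_in u (u\<^sub>0 @ y @ v\<^sub>0) v))"

definition syntactic_congruence :: "'a list set \<Rightarrow> ('a list \<times> 'a list) set" where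
  "syntactic_congruence L = {(x, y). x \<approx> y \<and>
     (\<forall>u v u\<^sub>0 v\<^sub>0. u\<^sub>0 @ word_of (first_letter x) \<in> gt_words \<longrightarrow>
        word_of (last_letter x) @ v\<^sub>0 \<in> lt_words \<longrightarrow>
        chain_in u (u\<^sub>0 @ x @ v\<^sub>0) v \<longrightarrow>
        (u @ u\<^sub>0 @ x @ v\<^sub>0 @ v \<in> L \<longleftrightarrow> u @ u\<^sub>0 @ y @ v\<^sub>0 @ v \<in> L))}"

text \<open>
  Configurations consist of a state, the remaining input and the stack; the top of the stack is
  the head of the list, and the empty stack is \<open>[]\<close>.
\<close>

inductive step ::
  "('a, 'q) opa \<Rightarrow> 'q \<times> 'a list \<times> ('a \<times> 'q) list \<Rightarrow> 'q \<times> 'a list \<times> ('a \<times> 'q) list \<Rightarrow> bool"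
  for M where
  push: "\<lbrakk> \<theta> = [] \<or> fst (hd \<theta>) \<lhd> a; (s, a, t) \<in> push_trans M \<rbrakk>
    \<Longrightarrow> step M (s, a # w, \<theta>) (t, w, (a, s) # \<theta>)"
| shift: "\<lbrakk> b \<doteq> a; (s, a, t) \<in> shift_trans M \<rbrakk>
    \<Longrightarrow> step M (s, a # w, (b, q) # \<theta>) (t, w, (a, q) # \<theta>)"
| pop: "\<lbrakk> Some b \<rhd>\<^sub>\<epsilon> first_letter w; (s, q, t) \<in> pop_trans M \<rbrakk>
    \<Longrightarrow> step M (s, w, (b, q) # \<theta>) (t, w, \<theta>)"

definition opa_language :: "('a, 'q) opa \<Rightarrow> 'a list set" where
  "opa_language M =
     {w. \<exists>q\<^sub>0 \<in> initial M. \<exists>q\<^sub>F \<in> accepting M. (step M)\<^sup>*\<^sup>* (q\<^sub>0, w, []) (q\<^sub>F, [], [])}"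

text \<open>
  State sets are taken from \<^typ>\<open>nat\<close>, because types cannot be quantified existentially. Lemma
  \<open>op_languageI\<close> below shows that this is no restriction.
\<close>

definition op_language :: "'a list set \<Rightarrow> bool" where
  "op_language L \<longleftrightarrow> (\<exists>M :: ('a, nat) opa. opa M \<and> opa_language M = L)"

end

definition rename_opa :: "('q \<Rightarrow> 'r) \<Rightarrow> ('a, 'q) opa \<Rightarrow> ('a, 'r) opa" where
  "rename_opa f M =
     \<lparr> states = f ` states M, initial = f ` initial M, accepting = f ` accepting M,
       push_trans = (\<lambda>(s, a, t). (f s, a, f t)) ` push_trans M,
       shift_trans = (\<lambda>(s, a, t). (f s, a, f t)) ` shift_trans M,
       pop_trans = (\<lambda>(s, q, t). (f s, f q, f t)) ` pop_trans M \<rparr>"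

definition rename_conf ::
    "('q \<Rightarrow> 'r) \<Rightarrow> 'q \<times> 'a list \<times> ('a \<times> 'q) list \<Rightarrow> 'r \<times> 'a list \<times> ('a \<times> 'r) list" where
  "rename_conf f = (\<lambda>(s, w, \<theta>). (f s, w, map (map_prod id f) \<theta>))"

definition conf_in :: "'q set \<Rightarrow> 'q \<times> 'a list \<times> ('a \<times> 'q) list \<Rightarrow> bool" where
  "conf_in Q = (\<lambda>(s, w, \<theta>). s \<in> Q \<and> snd ` set \<theta> \<subseteq> Q)"

context op_alphabet
begin

lemma step_rename:
  assumes "step M c d"
  shows "step (rename_opa f M) (rename_conf f c) (rename_conf f d)"
  using assms
proof cases
  case (push \<theta> a s t w)
  have "step (rename_opa f M) (f s, a # w, map (map_prod id f) \<theta>)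
          (f t, w, (a, f s) # map (map_prod id f) \<theta>)"
    by (rule step.push) (use push in \<open>cases \<theta>; force simp: rename_opa_def\<close>)+
  then show ?thesis using push by (simp add: rename_conf_def)
next
  case (shift b a s t w q \<theta>)
  have "step (rename_opa f M) (f s, a # w, (b, f q) # map (map_prod id f) \<theta>)
          (f t, w, (a, f q) # map (map_prod id f) \<theta>)"
    by (rule step.shift) (use shift in \<open>force simp: rename_opa_def\<close>)+
  then show ?thesis using shift by (simp add: rename_conf_def)
next
  case (pop b w s q t \<theta>)
  have "step (rename_opa f M) (f s, w, (b, f q) # map (map_prod id f) \<theta>)
          (f t, w, map (map_prod id f) \<theta>)"
    by (rule step.pop) (use pop in \<open>force simp: rename_opa_def\<close>)+
  then show ?thesis using pop by (simp add: rename_conf_def)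
qed

lemma step_conf_in:
  assumes "opa M" "step M c d" "conf_in (states M) c"
  shows "conf_in (states M) d"
  using assms(2) assms(1,3) by cases (auto simp: opa_def conf_in_def)

lemma step_rename_inv:
  assumes M: "opa M" and f: "inj_on f (states M)" and c: "conf_in (states M) c"
    and st: "step (rename_opa f M) (rename_conf f c) d'"
  shows "\<exists>d. step M c d \<and> d' = rename_conf f d"
proof -
  obtain s w \<theta> where [simp]: "c = (s, w, \<theta>)" by (cases c)
  have s: "s \<in> states M" and \<theta>: "snd ` set \<theta> \<subseteq> states M" using c by (auto simp: conf_in_def)
  note inj = inj_onD[OF f]
  show ?thesis using st
  proof cases
    case (push \<theta>' a s' t' w')
    then obtain s1 t where tr: "(s1, a, t) \<in> push_trans M" "f s1 = f s" "t' = f t"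
      by (auto simp: rename_opa_def rename_conf_def)
    then have "s1 = s" using M s inj[of s1 s] by (auto simp: opa_def)
    then have "step M (s, a # w', \<theta>) (t, w', (a, s) # \<theta>)"
      using push tr by (intro step.push) (cases \<theta>; auto simp: rename_conf_def)+
    moreover have "d' = rename_conf f (t, w', (a, s) # \<theta>)" "w = a # w'"
      using push tr by (auto simp: rename_conf_def)
    ultimately show ?thesis by auto
  next
    case (shift b a s' t' w' q' \<theta>')
    then obtain q \<theta>1 where th: "\<theta> = (b, q) # \<theta>1" "q' = f q" "\<theta>' = map (map_prod id f) \<theta>1"
      by (auto simp: rename_conf_def)
    obtain s1 t where tr: "(s1, a, t) \<in> shift_trans M" "f s1 = f s" "t' = f t"
      using shift by (auto simp: rename_opa_def rename_conf_def)
    then have "s1 = s" using M s inj[of s1 s] by (auto simp: opa_def)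
    then have "step M (s, a # w', (b, q) # \<theta>1) (t, w', (a, q) # \<theta>1)"
      using shift tr by (intro step.shift) auto
    moreover have "d' = rename_conf f (t, w', (a, q) # \<theta>1)" "w = a # w'"
      using shift tr th by (auto simp: rename_conf_def)
    ultimately show ?thesis using th by auto
  next
    case (pop b w' s' q' t' \<theta>')
    then obtain q \<theta>1 where th: "\<theta> = (b, q) # \<theta>1" "q' = f q" "\<theta>' = map (map_prod id f) \<theta>1"
      by (auto simp: rename_conf_def)
    obtain s1 q1 t where tr: "(s1, q1, t) \<in> pop_trans M" "f s1 = f s" "f q1 = f q" "t' = f t"
      using pop th by (auto simp: rename_opa_def rename_conf_def)
    then have "s1 = s" "q1 = q"
      using M s \<theta> th inj[of s1 s] inj[of q1 q] by (auto simp: opa_def)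
    then have "step M (s, w', (b, q) # \<theta>1) (t, w', \<theta>1)"
      using pop tr by (intro step.pop) auto
    moreover have "d' = rename_conf f (t, w', \<theta>1)" "w = w'"
      using pop tr th by (auto simp: rename_conf_def)
    ultimately show ?thesis using th by auto
  qed
qed

lemma steps_rename_inv:
  assumes "opa M" "inj_on f (states M)" "conf_in (states M) c"
    and "(step (rename_opa f M))\<^sup>*\<^sup>* (rename_conf f c) d'"
  shows "\<exists>d. (step M)\<^sup>*\<^sup>* c d \<and> conf_in (states M) d \<and> d' = rename_conf f d"
  using assms(4)
proof (induction rule: rtranclp_induct)
  case base
  then show ?case using assms(3) by blast
next
  case (step y z)
  then show ?case
    using step_rename_inv[OF assms(1,2)] step_conf_in[OF assms(1)]
    by (metis rtranclp.rtrancl_into_rtrancl)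
qed

lemma opa_language_rename:
  assumes M: "opa M" and f: "inj_on f (states M)"
  shows "opa_language (rename_opa f M) = opa_language M"
proof (intro equalityI subsetI)
  fix w assume "w \<in> opa_language M"
  then obtain q0 qF where q: "q0 \<in> initial M" "qF \<in> accepting M"
    and run: "(step M)\<^sup>*\<^sup>* (q0, w, []) (qF, [], [])" by (auto simp: opa_language_def)
  from run have "(step (rename_opa f M))\<^sup>*\<^sup>* (rename_conf f (q0, w, [])) (rename_conf f (qF, [], []))"
    by (induction rule: rtranclp_induct)
       (auto intro: rtranclp.rtrancl_into_rtrancl step_rename)
  then show "w \<in> opa_language (rename_opa f M)"
    using q by (auto simp: opa_language_def rename_opa_def rename_conf_def)
next
  fix w assume "w \<in> opa_language (rename_opa f M)"
  then obtain q0 qF where q: "q0 \<in> initial M" "qF \<in> accepting M"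
    and run: "(step (rename_opa f M))\<^sup>*\<^sup>* (f q0, w, []) (f qF, [], [])"
    by (auto simp: opa_language_def rename_opa_def)
  have "conf_in (states M) (q0, w, [])" using M q by (auto simp: opa_def conf_in_def)
  moreover have "(step (rename_opa f M))\<^sup>*\<^sup>* (rename_conf f (q0, w, [])) (f qF, [], [])"
    using run by (simp add: rename_conf_def)
  ultimately obtain d where d: "(step M)\<^sup>*\<^sup>* (q0, w, []) d"
    "conf_in (states M) d" "(f qF, [], []) = rename_conf f d"
    using steps_rename_inv[OF M f] by blast
  then obtain q where dq: "d = (q, [], [])" "q \<in> states M" "f q = f qF"
    by (cases d) (auto simp: rename_conf_def conf_in_def)
  moreover have "qF \<in> states M" using M q by (auto simp: opa_def)
  ultimately have "q = qF" using inj_onD[OF f] by blast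
  then show "w \<in> opa_language M" using q d dq by (auto simp: opa_language_def)
qed

lemma op_languageI:
  fixes M :: "('a, 'q) opa"
  assumes "opa M"
  shows "op_language (opa_language M)"
proof -
  have "finite (states M)" using assms by (simp add: opa_def)
  then obtain f :: "'q \<Rightarrow> nat" where f: "inj_on f (states M)"
    using finite_imp_inj_to_nat_seg by blast
  have "opa (rename_opa f M)"
    using assms by (fastforce simp: opa_def rename_opa_def)
  then show ?thesis
    unfolding op_language_def using opa_language_rename[OF assms f] by blast
qed

end

end

theory Submission
  imports Defs
begin

text \<open>
  A word is parsed by a stack that holds the last letters of the open handles. A body \<open>x\<close> is a chain
  between \<open>l\<close> and \<open>r\<close> iff parsing it above \<open>l\<close> never touches \<open>l\<close> and the lookahead \<open>r\<close> pops
  everything. In these terms the side conditions of the congruences say that in the context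
  \<open>u u\<^sub>0 x v\<^sub>0 v\<close> the first letter of \<open>x\<close> ends up alone on the stack above the last letter of \<open>u\<close>, and
  that no letter of \<open>v\<^sub>0\<close> pops the handle of the last letter of \<open>x\<close>.

  Hence an automaton with finitely many states can tell apart only finitely many words in such
  contexts: it matters from which states to which it can read \<open>x\<close>, with which state stored in the
  top handle, and what it can do when it later pops the handles below. The same argument for the
  automaton with one state and all transitions covers the chain equivalence.

  Conversely, let the automaton store congruence classes: of the text \<open>y\<close> that leads to the last
  letter of the top handle, and of the chain \<open>z\<close> read since. Pushing or shifting \<open>a\<close> and popping
  require the classes of \<open>z a\<close>, \<open>y z a\<close> and \<open>y z\<close>. The congruence is not compatible with arbitrary
  concatenation, but it is with these three.
\<close>

section \<open>Parsing chains with a stack\<close>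

context op_alphabet
begin

text \<open>
  The predicate \<open>P\<close> says which letters may be pushed on the empty stack: those above a left
  delimiter \<open>l\<close> for chains, all of them for \<^const>\<open>gt_words\<close>, and none for \<^const>\<open>lt_words\<close>.
\<close>

fun put :: "('a \<Rightarrow> bool) \<Rightarrow> 'a list \<Rightarrow> 'a \<Rightarrow> 'a list option" where
  "put P [] b = (if P b then Some [b] else None)"
| "put P (c # \<sigma>) b =
     (if c \<rhd> b then put P \<sigma> b else if c \<doteq> b then Some (b # \<sigma>) else Some (b # c # \<sigma>))"

text \<open>Only the last letter of each open handle is remembered. \<open>None\<close> means that a
  letter got down to the left delimiter and could not be pushed on it.\<close>

fun scan :: "('a \<Rightarrow> bool) \<Rightarrow> 'a list \<Rightarrow> 'a list \<Rightarrow> 'a list option" where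
  "scan P \<sigma> [] = Some \<sigma>"
| "scan P \<sigma> (b # w) = (case put P \<sigma> b of None \<Rightarrow> None | Some \<sigma>' \<Rightarrow> scan P \<sigma>' w)"

definition top_letter :: "'a option \<Rightarrow> 'a list \<Rightarrow> 'a option" where
  "top_letter l \<sigma> = (if \<sigma> = [] then l else Some (hd \<sigma>))"

abbreviation above :: "'a option \<Rightarrow> 'a \<Rightarrow> bool" where
  "above l \<equiv> \<lambda>b. l \<lhd>\<^sub>\<epsilon> Some b"

text \<open>The condition for transplanting a scan onto \<open>\<tau>\<close>: each letter that
  \<open>Q\<close> lets onto the empty stack becomes a push above \<open>\<tau>\<close>, so
  \<open>\<tau>\<close> is neither popped nor shifted.\<close>

definition supports :: "('a \<Rightarrow> bool) \<Rightarrow> ('a \<Rightarrow> bool) \<Rightarrow> 'a list \<Rightarrow> bool" where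
  "supports P Q \<tau> \<longleftrightarrow> (\<forall>b. Q b \<longrightarrow> (if \<tau> = [] then P b else hd \<tau> \<lhd> b))"

section \<open>Elementary and frame properties of scans\<close>

lemma trichotomy: "a \<lhd> b \<or> a \<rhd> b \<or> a \<doteq> b"
  and lt_not_gt: "a \<lhd> b \<Longrightarrow> \<not> a \<rhd> b"
  and lt_not_eq: "a \<lhd> b \<Longrightarrow> \<not> a \<doteq> b"
  and eq_not_gt: "a \<doteq> b \<Longrightarrow> \<not> a \<rhd> b"
  using exactly_one[of a b] by auto

lemma above_None [simp]: "above None = (\<lambda>_. True)"
  by auto

lemma above_Some [simp]: "above (Some c) = (\<lambda>b. c \<lhd> b)"
  by auto

lemma supports_False [simp]: "supports P (\<lambda>_. False) \<tau>"
  by (simp add: supports_def)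

lemma supports_top: "supports (above l) (above (top_letter l \<tau>)) \<tau>"
  by (simp add: supports_def top_letter_def)

lemma supports_Cons [simp]: "supports P (\<lambda>b. c \<lhd> b) (c # \<tau>)"
  by (simp add: supports_def)

lemma supports_True [simp]: "supports (\<lambda>_. True) Q []"
  by (simp add: supports_def)

lemma scan_append:
  "scan P \<sigma> (v @ w) = (case scan P \<sigma> v of None \<Rightarrow> None | Some \<sigma>' \<Rightarrow> scan P \<sigma>' w)"
  by (induction v arbitrary: \<sigma>) (auto split: option.splits)

lemma put_frame:
  "put Q \<sigma> b = Some \<sigma>' \<Longrightarrow> supports P Q \<tau> \<Longrightarrow> put P (\<sigma> @ \<tau>) b = Some (\<sigma>' @ \<tau>)"
proof (induction \<sigma>)
  case Nil
  then show ?case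
    by (cases \<tau>) (auto simp: supports_def lt_not_gt lt_not_eq split: if_splits)
qed (auto split: if_splits)

lemma scan_frame:
  "scan Q \<sigma> w = Some \<sigma>' \<Longrightarrow> supports P Q \<tau> \<Longrightarrow> scan P (\<sigma> @ \<tau>) w = Some (\<sigma>' @ \<tau>)"
  by (induction w arbitrary: \<sigma>) (auto simp: put_frame split: option.splits)

lemma scan_True: "scan Q \<sigma> w = Some \<sigma>' \<Longrightarrow> scan (\<lambda>_. True) \<sigma> w = Some \<sigma>'"
  using scan_frame[of Q \<sigma> w \<sigma>' "\<lambda>_. True" "[]"] by simp

lemma put_top: "put P \<sigma> b = Some \<sigma>' \<Longrightarrow> \<exists>\<sigma>''. \<sigma>' = b # \<sigma>''"
  by (induction \<sigma>) (auto split: if_splits)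

lemma scan_top: "scan P \<sigma> w = Some \<sigma>' \<Longrightarrow> w \<noteq> [] \<Longrightarrow> \<exists>\<sigma>''. \<sigma>' = last w # \<sigma>''"
proof (induction w arbitrary: \<sigma>)
  case (Cons b w)
  then obtain \<sigma>1 where s: "put P \<sigma> b = Some \<sigma>1" "scan P \<sigma>1 w = Some \<sigma>'"
    by (auto split: option.splits)
  then show ?case
    using Cons.IH[OF s(2)] put_top[OF s(1)] by (cases "w = []") auto
qed simp

lemma scan_top_letter:
  "scan P [] p = Some \<tau> \<Longrightarrow> top_letter l \<tau> = (if p = [] then l else last_letter p)"
  using scan_top[of P "[]" p \<tau>] by (auto simp: top_letter_def last_letter_def)

lemma put_pops: "\<forall>c \<in> set \<sigma>. c \<rhd> b \<Longrightarrow> put P (\<sigma> @ \<tau>) b = put P \<tau> b"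
  by (induction \<sigma>) auto

section \<open>Chain bodies built up from the left\<close>

inductive opens :: "('a option \<Rightarrow> 'a list \<Rightarrow> 'a option \<Rightarrow> bool) \<Rightarrow> 'a option \<Rightarrow> 'a list \<Rightarrow> bool"
  for R where
  start: "\<lbrakk> l \<lhd>\<^sub>\<epsilon> Some a; z = [] \<or> R l z (Some a) \<rbrakk> \<Longrightarrow> opens R l (z @ [a])"
| extend: "\<lbrakk> opens R l y; last y \<doteq> a; z = [] \<or> R (Some (last y)) z (Some a) \<rbrakk>
    \<Longrightarrow> opens R l (y @ z @ [a])"

lemma opens_not_Nil: "opens R l y \<Longrightarrow> y \<noteq> []"
  by (auto elim: opens.cases)

text \<open>The pair \<open>(as, us)\<close> lists the letters \<open>a\<^sub>i\<close> and the words \<open>u\<^sub>i\<^sub>-\<^sub>1\<close> in front of them.\<close>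

definition handle_word :: "'a list list \<Rightarrow> 'a list \<Rightarrow> 'a list" where
  "handle_word us as = concat (map2 (\<lambda>u a. u @ [a]) us as)"

lemma interleave_snoc:
  "length us = length as \<Longrightarrow> interleave (us @ [z]) as = handle_word us as @ z"
proof (induction us as rule: list_induct2)
  case Nil
  then show ?case by (simp add: interleave_def handle_word_def)
next
  case (Cons u us a as)
  then show ?case
    by (cases us) (auto simp: interleave_def handle_word_def)
qed

text \<open>\<open>opens\<close> covers the prefix of a chain body up to its last letter
  \<open>a\<^sub>n\<close>, which does not depend on the right delimiter. The relation
  \<open>R\<close> is a parameter so that an induction hypothesis about the inner words can be
  carried along.\<close>

lemma opens_handle_word:
  assumes "as \<noteq> []" "l \<lhd>\<^sub>\<epsilon> Some (hd as)" "successively (\<doteq>) as" "length us = length as"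
    and "\<forall>i < length as. us ! i = [] \<or> R ((l # map Some as) ! i) (us ! i) (Some (as ! i))"
  shows "opens R l (handle_word us as) \<and> last (handle_word us as) = last as"
  using assms
proof (induction as arbitrary: us rule: rev_induct)
  case (snoc a as)
  obtain us' z where us: "us = us' @ [z]" and len: "length us' = length as"
    using snoc.prems(4) by (cases us rule: rev_cases) auto
  have w: "handle_word us (as @ [a]) = handle_word us' as @ z @ [a]"
    using len by (simp add: us handle_word_def)
  \<comment> \<open>Index \<open>length as\<close> gives the left delimiter of \<open>z\<close>: the
    last letter of \<open>as\<close>, or \<open>l\<close> if \<open>as\<close> is empty.\<close>
  have z: "z = [] \<or> R ((l # map Some as) ! length as) z (Some a)"
    using snoc.prems(5)[rule_format, of "length as"] len
    by (cases as) (auto simp: us nth_append nth_Cons')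
  show ?case
  proof (cases "as = []")
    case True
    then show ?thesis
      using z w snoc.prems len opens.start[of l a z R] by (simp add: handle_word_def)
  next
    case False
    have cond: "us' ! i = [] \<or> R ((l # map Some as) ! i) (us' ! i) (Some (as ! i))"
      if "i < length as" for i
      using snoc.prems(5)[rule_format, of i] that len
      by (auto simp: us nth_append nth_Cons' less_imp_diff_less)
    have IH: "opens R l (handle_word us' as)" "last (handle_word us' as) = last as"
      using snoc.IH[of us'] False snoc.prems len cond by (auto simp: successively_append_iff)
    have "(l # map Some as) ! length as = Some (last as)"
      using False by (simp add: nth_Cons' last_conv_nth)
    then show ?thesis
      using opens.extend[OF IH(1), of a z] z IH(2) False w snoc.prems
      by (simp add: successively_append_iff)
  qed
qed simp

lemma opens_imp_handle_word:
  assumes "opens R l y"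
  shows "\<exists>us as. y = handle_word us as \<and> as \<noteq> [] \<and> l \<lhd>\<^sub>\<epsilon> Some (hd as) \<and> successively (\<doteq>) as \<and>
    length us = length as \<and> last as = last y \<and>
    (\<forall>i < length as. us ! i = [] \<or> R ((l # map Some as) ! i) (us ! i) (Some (as ! i)))"
  using assms
proof induction
  case (start l a z)
  then show ?case
    by (intro exI[of _ "[z]"] exI[of _ "[a]"]) (auto simp: handle_word_def)
next
  case (extend l y a z)
  then obtain us as where h: "y = handle_word us as" "as \<noteq> []" "l \<lhd>\<^sub>\<epsilon> Some (hd as)"
    "successively (\<doteq>) as" "length us = length as" "last as = last y"
    and c: "\<forall>i < length as. us ! i = [] \<or> R ((l # map Some as) ! i) (us ! i) (Some (as ! i))"
    by blast
  have "(l # map Some as) ! length as = Some (last as)"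
    using h(2) by (simp add: nth_Cons' last_conv_nth)
  then have "(us @ [z]) ! i = [] \<or>
    R ((l # map Some (as @ [a])) ! i) ((us @ [z]) ! i) (Some ((as @ [a]) ! i))"
    if "i < length (as @ [a])" for i
    using c[rule_format, of i] that extend.hyps h(5,6)
    by (cases "i = length as") (auto simp: nth_append nth_Cons')
  then show ?case
    using h extend.hyps
    by (intro exI[of _ "us @ [z]"] exI[of _ "as @ [a]"])
       (auto simp: handle_word_def successively_append_iff)
qed

text \<open>Only the last inner word is delimited by \<open>r\<close>; with it split off,
  \<open>chainI\<close> becomes a rule about \<open>opens\<close>.\<close>

lemma chain_closeI:
  assumes "opens chain l y" "Some (last y) \<rhd>\<^sub>\<epsilon> r" "z = [] \<or> chain (Some (last y)) z r"
  shows "chain l (y @ z) r"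
proof -
  obtain us as where h: "y = handle_word us as" "as \<noteq> []" "l \<lhd>\<^sub>\<epsilon> Some (hd as)"
    "successively (\<doteq>) as" "length us = length as" "last as = last y"
    and c: "\<forall>i < length as. us ! i = [] \<or> chain ((l # map Some as) ! i) (us ! i) (Some (as ! i))"
    using opens_imp_handle_word[OF assms(1)] by blast
  have e: "(l # map Some as) ! length as = Some (last as)"
    using h(2) by (simp add: nth_Cons' last_conv_nth)
  have "chain l (interleave (us @ [z]) as) r"
  proof (rule chainI, goal_cases)
    case 6
    show ?case
    proof (intro allI impI)
      fix i assume "i \<le> length as"
      then show "(us @ [z]) ! i = [] \<or>
        chain ((l # map Some as @ [r]) ! i) ((us @ [z]) ! i) ((l # map Some as @ [r]) ! Suc i)"
        using c[rule_format, of i] e assms(3) h(2,5,6)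
        by (cases "i = length as") (auto simp: nth_append nth_Cons')
    qed
  qed (use h assms(2) in auto)
  then show ?thesis using h by (simp add: interleave_snoc)
qed

section \<open>From chains to scans\<close>

definition reducible_over :: "'a option \<Rightarrow> 'a list \<Rightarrow> 'a option \<Rightarrow> bool" where
  "reducible_over l w r \<longleftrightarrow>
     w \<noteq> [] \<and> (\<exists>\<sigma>. scan (above l) [] w = Some \<sigma> \<and> (\<forall>c \<in> set \<sigma>. Some c \<rhd>\<^sub>\<epsilon> r))"

lemma scan_reducible:
  assumes "z = [] \<or> reducible_over l z r" "supports P (above l) \<tau>"
  shows "\<exists>\<sigma>. scan P \<tau> z = Some (\<sigma> @ \<tau>) \<and> (\<forall>c \<in> set \<sigma>. Some c \<rhd>\<^sub>\<epsilon> r)"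
proof (cases "z = []")
  case False
  then show ?thesis
    using assms scan_frame[of "above l" "[]" z _ P \<tau>] unfolding reducible_over_def by fastforce
qed auto

text \<open>What \<open>z\<close> leaves above \<open>\<tau>\<close> is popped by \<open>b\<close>
  before \<open>b\<close> meets \<open>\<tau>\<close>.\<close>

lemma scan_skip:
  assumes "z = [] \<or> reducible_over l z (Some b)" "supports P (above l) \<tau>"
  shows "scan P \<tau> (z @ b # w) = scan P \<tau> (b # w)"
  using scan_reducible[OF assms] by (auto simp: scan_append put_pops)

text \<open>The inner words are skipped, so only the letters \<open>a\<^sub>i\<close> act: the first
  is pushed and each further one replaces its predecessor.\<close>

lemma scan_opens:
  assumes "opens R l y" "\<And>l z r. R l z r \<Longrightarrow> reducible_over l z r"
  shows "scan (above l) [] y = Some [last y]"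
  using assms(1)
proof induction
  case (start l a z)
  then have "scan (above l) [] (z @ a # []) = scan (above l) [] (a # [])"
    by (intro scan_skip) (use assms(2) in \<open>auto simp: supports_def\<close>)
  then show ?case using start by simp
next
  case (extend l y a z)
  then have "scan (above l) [last y] (z @ a # []) = scan (above l) [last y] (a # [])"
    by (intro scan_skip[of _ "Some (last y)"]) (use assms(2) in \<open>auto simp: supports_def\<close>)
  then show ?case using extend by (simp add: scan_append eq_not_gt)
qed

text \<open>By the induction hypotheses the body up to its last letter \<open>a\<^sub>n\<close>
  scans to that letter alone; the last inner word is read above it, and \<open>r\<close> pops
  whatever remains.\<close>

lemma chain_imp_reducible: "chain l w r \<Longrightarrow> reducible_over l w r"
proof (induction rule: chain.induct)
  case (chainI as l r us)
  obtain us' z where us: "us = us' @ [z]" and len: "length us' = length as"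
    using chainI.hyps(5) by (cases us rule: rev_cases) auto
  let ?R = "\<lambda>l w r. chain l w r \<and> reducible_over l w r"
  have c: "us' ! i = [] \<or> ?R ((l # map Some as) ! i) (us' ! i) (Some (as ! i))"
    if "i < length as" for i
    using chainI.IH[rule_format, of i] that len
    by (auto simp: us nth_append nth_Cons' less_imp_diff_less)
  have "(l # map Some as) ! length as = Some (last as)"
    using chainI.hyps(1) by (simp add: nth_Cons' last_conv_nth)
  then have z: "z = [] \<or> reducible_over (Some (last as)) z r"
    using chainI.IH[rule_format, of "length as"] len chainI.hyps(1)
    by (auto simp: us nth_append nth_Cons' split: if_splits)
  have op: "opens ?R l (handle_word us' as)" and lst: "last (handle_word us' as) = last as"
    using opens_handle_word[of as l us' ?R] chainI.hyps len c by auto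
  have "scan (above l) [] (handle_word us' as) = Some [last as]"
    using scan_opens[OF op] lst by simp
  moreover have "\<exists>\<sigma>. scan (above l) [last as] z = Some (\<sigma> @ [last as]) \<and> (\<forall>c \<in> set \<sigma>. Some c \<rhd>\<^sub>\<epsilon> r)"
    by (rule scan_reducible[OF z]) simp
  ultimately show ?case
    using chainI.hyps(4) opens_not_Nil[OF op] len
    by (auto simp: reducible_over_def us interleave_snoc scan_append)
qed

section \<open>From scans to chains\<close>

inductive layers :: "'a option \<Rightarrow> 'a list \<Rightarrow> 'a list \<Rightarrow> bool" for l where
  "layers l [] []"
| "\<lbrakk> layers l x \<sigma>; opens chain (top_letter l \<sigma>) y \<rbrakk> \<Longrightarrow> layers l (x @ y) (last y # \<sigma>)"

text \<open>\<open>layers\<close> assigns to each stack letter an unfinished handle over the letter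
  below. When \<open>r\<close> pops a letter, its handle and the chain \<open>z\<close> behind it
  merge into one chain of the layer below.\<close>

lemma layers_close:
  assumes "layers l x (\<sigma> @ \<tau>)" "\<forall>c \<in> set \<sigma>. Some c \<rhd>\<^sub>\<epsilon> r"
    "z = [] \<or> chain (top_letter l (\<sigma> @ \<tau>)) z r"
  shows "\<exists>x' z'. x @ z = x' @ z' \<and> layers l x' \<tau> \<and> (z' = [] \<or> chain (top_letter l \<tau>) z' r)"
  using assms
proof (induction \<sigma> arbitrary: x z)
  case (Cons c \<sigma>)
  obtain x' y where h: "x = x' @ y" "layers l x' (\<sigma> @ \<tau>)"
    "opens chain (top_letter l (\<sigma> @ \<tau>)) y" "last y = c"
    using Cons.prems(1) by (auto elim: layers.cases)
  have "chain (top_letter l (\<sigma> @ \<tau>)) (y @ z) r"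
    by (rule chain_closeI) (use h Cons.prems in \<open>auto simp: top_letter_def\<close>)
  then show ?case
    using Cons.IH[OF h(2), of "y @ z"] Cons.prems(2) h(1) by auto
qed auto

lemma put_split:
  "put P \<sigma> b = Some \<sigma>' \<Longrightarrow> \<exists>\<rho> \<tau>. \<sigma> = \<rho> @ \<tau> \<and> (\<forall>c \<in> set \<rho>. c \<rhd> b) \<and> put P \<tau> b = Some \<sigma>' \<and>
     (\<tau> = [] \<or> \<not> hd \<tau> \<rhd> b)"
proof (induction \<sigma>)
  case (Cons c \<sigma>)
  show ?case
  proof (cases "c \<rhd> b")
    case True
    then obtain \<rho> \<tau> where "\<sigma> = \<rho> @ \<tau>" "\<forall>c \<in> set \<rho>. c \<rhd> b" "put P \<tau> b = Some \<sigma>'"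
      "\<tau> = [] \<or> \<not> hd \<tau> \<rhd> b"
      using Cons by auto
    then show ?thesis using True by (intro exI[of _ "c # \<rho>"] exI[of _ \<tau>]) auto
  next
    case False
    then show ?thesis using Cons.prems by (intro exI[of _ "[]"] exI[of _ "c # \<sigma>"]) auto
  qed
qed auto

text \<open>The popped letters leave a chain \<open>z\<close> in front of \<open>b\<close>; then
  \<open>b\<close> either extends the handle on top, with \<open>z\<close> as inner word, or starts
  a new handle with \<open>z\<close> in front.\<close>

lemma layers_put:
  assumes "layers l x \<sigma>" "put (above l) \<sigma> b = Some \<sigma>'"
  shows "layers l (x @ [b]) \<sigma>'"
proof -
  obtain \<rho> \<tau> where s: "\<sigma> = \<rho> @ \<tau>" "\<forall>c \<in> set \<rho>. c \<rhd> b" "put (above l) \<tau> b = Some \<sigma>'"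
    "\<tau> = [] \<or> \<not> hd \<tau> \<rhd> b"
    using put_split[OF assms(2)] by blast
  obtain x' z where x: "x = x' @ z" "layers l x' \<tau>"
    "z = [] \<or> chain (top_letter l \<tau>) z (Some b)"
    using layers_close[of l x \<rho> \<tau> "Some b" "[]"] assms(1) s by auto
  have pushed: "layers l (x @ [b]) (b # \<tau>)" if "top_letter l \<tau> \<lhd>\<^sub>\<epsilon> Some b"
    using layers.intros(2)[OF x(2) opens.start[where R = chain, OF that x(3)]] x(1) by simp
  show ?thesis
  proof (cases \<tau>)
    case Nil
    then show ?thesis using s pushed by (auto simp: top_letter_def split: if_splits)
  next
    case (Cons c \<tau>')
    show ?thesis
    proof (cases "c \<doteq> b")
      case True
      obtain x'' y where h: "x' = x'' @ y" "layers l x'' \<tau>'"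
        "opens chain (top_letter l \<tau>') y" "last y = c"
        using x(2) Cons by (auto elim: layers.cases)
      have "opens chain (top_letter l \<tau>') (y @ z @ [b])"
        by (rule opens.extend) (use h True x Cons in \<open>auto simp: top_letter_def\<close>)
      from layers.intros(2)[OF h(2) this] show ?thesis
        using s Cons True x h by (simp add: eq_not_gt)
    next
      case False
      then have "c \<lhd> b" using s Cons trichotomy by auto
      then show ?thesis using s Cons False pushed by (auto simp: top_letter_def)
    qed
  qed
qed

lemma layers_scan:
  "layers l x \<sigma> \<Longrightarrow> scan (above l) \<sigma> w = Some \<sigma>' \<Longrightarrow> layers l (x @ w) \<sigma>'"
proof (induction w arbitrary: x \<sigma>)
  case (Cons b w)
  then obtain \<sigma>1 where s: "put (above l) \<sigma> b = Some \<sigma>1" "scan (above l) \<sigma>1 w = Some \<sigma>'"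
    by (auto split: option.splits)
  then show ?case using Cons.IH[OF layers_put[OF Cons.prems(1) s(1)] s(2)] by simp
qed simp

lemma layers_Nil: "layers l x [] \<Longrightarrow> x = []"
  by (auto elim: layers.cases)

text \<open>From right to left, \<open>r\<close> closes all layers of the final stack one after the
  other; the prefix that remains has no layers and is empty, so the whole word is one chain.\<close>

theorem chain_iff_scan:
  "chain l w r \<longleftrightarrow>
     w \<noteq> [] \<and> (\<exists>\<sigma>. scan (above l) [] w = Some \<sigma> \<and> (\<forall>c \<in> set \<sigma>. Some c \<rhd>\<^sub>\<epsilon> r))"
proof
  assume "chain l w r"
  then show "w \<noteq> [] \<and> (\<exists>\<sigma>. scan (above l) [] w = Some \<sigma> \<and> (\<forall>c \<in> set \<sigma>. Some c \<rhd>\<^sub>\<epsilon> r))"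
    using chain_imp_reducible unfolding reducible_over_def by blast
next
  assume "w \<noteq> [] \<and> (\<exists>\<sigma>. scan (above l) [] w = Some \<sigma> \<and> (\<forall>c \<in> set \<sigma>. Some c \<rhd>\<^sub>\<epsilon> r))"
  then obtain \<sigma> where s: "w \<noteq> []" "scan (above l) [] w = Some \<sigma>" "\<forall>c \<in> set \<sigma>. Some c \<rhd>\<^sub>\<epsilon> r"
    by blast
  have "layers l w (\<sigma> @ [])" using layers_scan[OF layers.intros(1) s(2)] by simp
  then show "chain l w r"
    using layers_close[of l w \<sigma> "[]" r "[]"] s by (auto simp: top_letter_def dest!: layers_Nil)
qed

lemmas reducible_over_iff_chain = reducible_over_def[folded chain_iff_scan]

lemmas scan_chain = scan_reducible[unfolded reducible_over_iff_chain]
  and scan_skip_chain = scan_skip[unfolded reducible_over_iff_chain]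

end

section \<open>Collapsing\<close>

context op_alphabet
begin

text \<open>When the scan reaches the removed body, the top of the stack is the last letter of
  \<open>x\<close>, its left delimiter, so the body is skipped. The first letter survives because
  \<open>x\<close> is nonempty.\<close>

lemma collapse_step_Cons:
  assumes "collapse_step w w'"
  shows "\<exists>a v v'. w = a # v \<and> w' = a # v' \<and> (\<forall>P. scan P [a] v = scan P [a] v')"
  using assms
proof cases
  case (1 x y z)
  obtain a x' where x: "x = a # x'" using 1 by (cases x) auto
  obtain b z' where z: "z = b # z'" using 1 by (cases z) auto
  have ch: "y = [] \<or> chain (last_letter x) y (Some b)"
    using 1 z by (simp add: chain_in_def first_letter_def)
  have "scan P [a] (x' @ y @ z) = scan P [a] (x' @ z)" for P
  proof (cases "scan P [a] x'")
    case (Some \<tau>)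
    then have "\<exists>\<tau>'. \<tau> = last x # \<tau>'"
      using scan_top[OF Some] x by (cases "x' = []") auto
    then have "supports P (above (last_letter x)) \<tau>"
      using x by (auto simp: last_letter_def)
    then show ?thesis
      using scan_skip_chain[OF ch] Some by (simp add: scan_append z)
  qed (simp add: scan_append)
  then show ?thesis using x 1 by auto
qed

lemma collapse_steps_Cons:
  assumes "collapse_step\<^sup>*\<^sup>* (a # v) w'"
  shows "\<exists>v'. w' = a # v' \<and> (\<forall>P. scan P [a] v = scan P [a] v')"
  using assms
proof (induction rule: rtranclp_induct)
  case (step y z)
  then show ?case using collapse_step_Cons[OF step.hyps(2)] by auto
qed auto

text \<open>
  A refinement of \<^const>\<open>put\<close> whose stack entries are whole handles, in reverse; it keeps exactly
  the letters that survive collapsing.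
\<close>

fun keep :: "'a list list \<Rightarrow> 'a \<Rightarrow> 'a list list" where
  "keep [] b = [[b]]"
| "keep (h # hs) b =
     (if hs \<noteq> [] \<and> hd h \<rhd> b then keep hs b
      else if hd h \<lhd> b then [b] # h # hs else (b # h) # hs)"

abbreviation kept :: "'a list list \<Rightarrow> 'a list" where
  "kept S \<equiv> rev (concat S)"

text \<open>Above an entry \<open>h\<close> only the heads of entries matter, and the protection of
  the bottom entry from popping does not take effect; so \<open>keep\<close> mirrors
  \<open>put\<close> for the delimiter \<open>hd h\<close>.\<close>

lemma keep_put:
  "put (above (Some (hd h))) (map hd H) b = Some \<sigma> \<Longrightarrow>
    \<exists>H'. keep (H @ h # hs) b = H' @ h # hs \<and> map hd H' = \<sigma>"
proof (induction H)
  case Nil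
  then show ?case
    by (auto simp: lt_not_gt split: if_splits intro: exI[of _ "[[b]]"])
next
  case (Cons g H)
  consider "hd g \<rhd> b" | "hd g \<lhd> b" | "hd g \<doteq> b" using trichotomy by blast
  then show ?case
  proof cases
    case 2
    then show ?thesis
      using Cons.prems
      by (auto simp: lt_not_gt lt_not_eq intro!: exI[of _ "[b] # g # H"])
  next
    case 3
    then have "\<not> hd g \<rhd> b" "\<not> hd g \<lhd> b" using exactly_one by blast+
    then show ?thesis
      using Cons.prems 3 by (auto intro!: exI[of _ "(b # g) # H"])
  qed (use Cons in auto)
qed

lemma keep_scan:
  "scan (above (Some (hd h))) (map hd H) w = Some \<sigma> \<Longrightarrow>
    \<exists>H'. foldl keep (H @ h # hs) w = H' @ h # hs \<and> map hd H' = \<sigma>"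
proof (induction w arbitrary: H)
  case (Cons b w)
  then obtain \<sigma>1 where s: "put (above (Some (hd h))) (map hd H) b = Some \<sigma>1"
    "scan (above (Some (hd h))) \<sigma>1 w = Some \<sigma>"
    by (auto split: option.splits)
  from keep_put[OF s(1)] obtain H1
    where H1: "keep (H @ h # hs) b = H1 @ h # hs" "map hd H1 = \<sigma>1"
    by blast
  then show ?case using Cons.IH[of H1] s(2) by simp
qed auto

lemma keep_pops: "\<forall>g \<in> set H. hd g \<rhd> b \<Longrightarrow> S \<noteq> [] \<Longrightarrow> keep (H @ S) b = keep S b"
  by (induction H) auto

lemma keep_top: "\<exists>h hs. keep S b = h # hs \<and> hd h = b"
  by (induction S) auto

lemma foldl_keep_top: "w \<noteq> [] \<Longrightarrow> \<exists>h hs. foldl keep S w = h # hs \<and> hd h = last w"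
  by (induction w rule: rev_induct) (use keep_top in auto)

text \<open>The body leaves entries above the one headed by the last letter of \<open>x\<close>, and
  the first letter of \<open>z\<close> pops them all.\<close>

lemma collapse_step_keep:
  assumes "collapse_step w w'"
  shows "foldl keep [] w = foldl keep [] w'"
  using assms
proof cases
  case (1 x y z)
  obtain b z' where z: "z = b # z'" using 1 by (cases z) auto
  obtain h hs where S: "foldl keep [] x = h # hs" "hd h = last x"
    using foldl_keep_top 1 by blast
  obtain \<sigma> where s: "scan (above (Some (hd h))) [] y = Some \<sigma>" "\<forall>c \<in> set \<sigma>. c \<rhd> b"
    using 1 S by (auto simp: z chain_in_def chain_iff_scan last_letter_def first_letter_def)
  from keep_scan[of h "[]" y \<sigma> hs] s(1) obtain H
    where "foldl keep (h # hs) y = H @ h # hs" "map hd H = \<sigma>"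
    by auto
  then show ?thesis
    using 1 S s(2) by (auto simp: z keep_pops)
qed

text \<open>The bottom entry is exempt: having no letter to its left, it is never collapsed and
  collects letters in any relation but \<open>\<lhd>\<close>.\<close>

fun handles :: "'a list list \<Rightarrow> bool" where
  "handles [] \<longleftrightarrow> True"
| "handles (h # hs) \<longleftrightarrow> h \<noteq> [] \<and> handles hs \<and>
     (hs \<noteq> [] \<longrightarrow> successively (\<doteq>) (rev h) \<and> hd (hd hs) \<lhd> last h)"

lemma handles_keep: "handles S \<Longrightarrow> handles (keep S b)"
proof (induction S)
  case (Cons h hs)
  then show ?case
    using trichotomy[of "hd h" b]
    by (auto simp: successively_append_iff last_rev)
qed simp

lemma chain_handle:
  assumes "h \<noteq> []" "successively (\<doteq>) (rev h)" "l \<lhd>\<^sub>\<epsilon> Some (last h)" "Some (hd h) \<rhd>\<^sub>\<epsilon> r"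
  shows "chain l (rev h) r"
proof -
  \<comment> \<open>All inner words are empty: the handle is the body of a simple chain.\<close>
  let ?us = "replicate (length h) []"
  have "opens chain l (handle_word ?us (rev h)) \<and> last (handle_word ?us (rev h)) = last (rev h)"
    by (rule opens_handle_word) (use assms in \<open>auto simp: hd_rev\<close>)
  moreover have "handle_word (replicate (length w) []) w = w" for w :: "'a list"
    by (induction w) (auto simp: handle_word_def)
  from this[of "rev h"] have "handle_word ?us (rev h) = rev h" by simp
  ultimately show ?thesis
    using chain_closeI[of l "rev h" r "[]"] assms by (simp add: last_rev)
qed

text \<open>The only way to lose letters is to pop an entry above the bottom one. Such an entry is
  the body of a simple chain between the letter below and \<open>b\<close>, which an irreducible
  word does not contain.\<close>

lemma keep_irreducible:
  assumes "handles S" "\<nexists>v. collapse_step (kept S @ b # w) v"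
  shows "kept (keep S b) = kept S @ [b]"
  using assms
proof (cases S)
  case (Cons h hs)
  have "\<not> (hs \<noteq> [] \<and> hd h \<rhd> b)"
  proof
    assume a: "hs \<noteq> [] \<and> hd h \<rhd> b"
    then obtain g gs where hs: "hs = g # gs" by (cases hs) auto
    have "collapse_step (kept hs @ rev h @ b # w) (kept hs @ b # w)"
    proof (rule collapse_step.intros)
      have "g \<noteq> []" using assms Cons hs by auto
      then have "last_letter (kept hs) = Some (hd g)"
        by (simp add: last_letter_def hs last_rev hd_append)
      then show "chain_in (kept hs) (rev h) (b # w)"
        unfolding chain_in_def using a assms(1) Cons hs
        by (intro chain_handle) (auto simp: first_letter_def)
    qed (use assms(1) Cons hs in auto)
    then show False using assms(2) Cons by auto
  qed
  then show ?thesis using Cons by auto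
qed simp

lemma foldl_keep_irreducible:
  "handles S \<Longrightarrow> \<nexists>v. collapse_step (kept S @ w) v \<Longrightarrow> kept (foldl keep S w) = kept S @ w"
proof (induction w arbitrary: S)
  case (Cons b w)
  then show ?case
    using Cons.IH[OF handles_keep, of S b] keep_irreducible[of S b w] by simp
qed simp

lemma collapse_step_length: "collapse_step w w' \<Longrightarrow> length w' < length w"
  by (auto elim: collapse_step.cases)

lemma collapse_exists: "\<exists>v. collapse_step\<^sup>*\<^sup>* w v \<and> (\<nexists>v'. collapse_step v v')"
proof (induction w rule: length_induct)
  case (1 w)
  then show ?case
    by (cases "\<exists>v'. collapse_step w v'")
      (use collapse_step_length in \<open>blast intro: converse_rtranclp_into_rtranclp\<close>)+
qed

text \<open>The stack computed by \<open>keep\<close> is invariant under collapsing and reproduces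
  irreducible words, which replaces a confluence argument.\<close>

lemma collapse_unique:
  assumes "collapse_step\<^sup>*\<^sup>* w v" "\<nexists>v'. collapse_step v v'"
  shows "v = kept (foldl keep [] w)"
proof -
  have "foldl keep [] w = foldl keep [] v"
    using assms(1) by (induction rule: rtranclp_induct) (auto dest: collapse_step_keep)
  then show ?thesis
    using foldl_keep_irreducible[of "[]" v] assms(2) by simp
qed

lemma collapse_eq_kept: "collapse w = kept (foldl keep [] w)"
  unfolding collapse_def
  using collapse_exists[of w] collapse_unique[of w] by (intro the_equality) metis+

lemma collapse_steps: "collapse_step\<^sup>*\<^sup>* w (collapse w)"
  using collapse_exists[of w] collapse_unique collapse_eq_kept by metis

section \<open>The side conditions in terms of scans\<close>

lemma scan_gt:
  "successively (\<lambda>a b. a \<rhd> b \<or> a \<doteq> b) (a # v) \<Longrightarrow> scan (\<lambda>_. True) [a] v = Some [last (a # v)]"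
  by (induction v arbitrary: a) (auto simp: eq_not_gt)

lemma scan_lt:
  "successively (\<lambda>a b. a \<lhd> b \<or> a \<doteq> b) (a # v) \<Longrightarrow> scan P (a # \<sigma>) v \<noteq> None"
  by (induction v arbitrary: a \<sigma>) (auto simp: eq_not_gt lt_not_gt lt_not_eq)

text \<open>Collapsing does not change the scan, and over the collapsed word the stack never holds
  more than one letter.\<close>

lemma gt_words_scan:
  assumes "w @ [a] \<in> gt_words" "scan P [] (w @ [a]) = Some \<sigma>"
  shows "\<sigma> = [a]"
proof -
  obtain b v where v: "w @ [a] = b # v" by (cases "w @ [a]") auto
  obtain v' where v': "collapse (b # v) = b # v'"
    "scan (\<lambda>_. True) [b] v = scan (\<lambda>_. True) [b] v'"
    using collapse_steps_Cons[OF collapse_steps] by metis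
  have "v' = [] \<or> successively (\<lambda>a b. a \<rhd> b \<or> a \<doteq> b) (b # v')"
    using assms(1) v' by (auto simp: v gt_words_def)
  then have "scan (\<lambda>_. True) [b] v = Some [last (b # v')]"
    using v'(2) scan_gt[of b v'] by auto
  moreover have "scan (\<lambda>_. True) [b] v = Some \<sigma>"
    using scan_True[OF assms(2)] by (simp add: v)
  ultimately obtain c where c: "\<sigma> = [c]" by simp
  then show ?thesis using scan_top[OF assms(2)] by simp
qed

text \<open>Since no letter may enter an empty stack, the bottom entry is never popped, and this is
  where \<open>keep\<close> and \<open>put\<close> would part.\<close>

lemma put_False_kept:
  assumes "put (\<lambda>_. False) (map hd S) b = Some \<sigma>" "\<forall>h \<in> set S. h \<noteq> []"
    "successively (\<lambda>a b. a \<lhd> b \<or> a \<doteq> b) (kept S)"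
  shows "map hd (keep S b) = \<sigma> \<and> (\<forall>h \<in> set (keep S b). h \<noteq> []) \<and>
    successively (\<lambda>a b. a \<lhd> b \<or> a \<doteq> b) (kept (keep S b))"
  using assms
proof (induction S)
  case (Cons h hs)
  have h: "h \<noteq> []" "last (rev h) = hd h" using Cons.prems(2) by (auto simp: last_rev)
  have hs: "successively (\<lambda>a b. a \<lhd> b \<or> a \<doteq> b) (kept hs)"
    using Cons.prems(3) by (simp add: successively_append_iff)
  show ?case
  proof (cases "hd h \<rhd> b")
    case True
    then have "hs \<noteq> []" using Cons.prems(1) by auto
    then show ?thesis using Cons.IH hs Cons.prems True by simp
  next
    case False
    then have "hd h \<lhd> b \<or> hd h \<doteq> b" using trichotomy by blast
    then have "successively (\<lambda>a b. a \<lhd> b \<or> a \<doteq> b) (kept (h # hs) @ [b])"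
      using Cons.prems(3) h by (subst successively_append_iff) simp
    then show ?thesis
      using False Cons.prems(1,2) trichotomy[of "hd h" b] lt_not_eq[of "hd h" b]
      by (auto simp del: successively_rev)
  qed
qed simp

lemma scan_False_kept:
  assumes "scan (\<lambda>_. False) (map hd S) w \<noteq> None" "\<forall>h \<in> set S. h \<noteq> []"
    "successively (\<lambda>a b. a \<lhd> b \<or> a \<doteq> b) (kept S)"
  shows "successively (\<lambda>a b. a \<lhd> b \<or> a \<doteq> b) (kept (foldl keep S w))"
  using assms
proof (induction w arbitrary: S)
  case (Cons b w)
  then obtain \<sigma> where s: "put (\<lambda>_. False) (map hd S) b = Some \<sigma>"
    by (cases "put (\<lambda>_. False) (map hd S) b") auto
  then show ?case
    using put_False_kept[OF s Cons.prems(2,3)] Cons.prems(1) Cons.IH[of "keep S b"] by simp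
qed simp

text \<open>The predicate that admits nothing makes the scan fail as soon as the handle that begins
  with \<open>a\<close> is popped. One direction passes to the collapsed word, the other follows the
  scan with \<open>keep\<close>.\<close>

lemma lt_words_scan: "a # v \<in> lt_words \<longleftrightarrow> scan (\<lambda>_. False) [a] v \<noteq> None"
proof
  obtain v' where v': "collapse (a # v) = a # v'"
    "scan (\<lambda>_. False) [a] v = scan (\<lambda>_. False) [a] v'"
    using collapse_steps_Cons[OF collapse_steps] by metis
  assume "a # v \<in> lt_words"
  then have "v' = [] \<or> successively (\<lambda>a b. a \<lhd> b \<or> a \<doteq> b) (a # v')"
    by (auto simp: lt_words_def v')
  then show "scan (\<lambda>_. False) [a] v \<noteq> None"
    using v'(2) scan_lt[of a v' _ "[]"] by auto
next
  assume "scan (\<lambda>_. False) [a] v \<noteq> None"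
  then show "a # v \<in> lt_words"
    using scan_False_kept[of "[[a]]" v] by (simp add: lt_words_def collapse_eq_kept)
qed

lemma singleton_gt [simp]: "[a] \<in> gt_words"
  and singleton_lt [simp]: "[a] \<in> lt_words"
  by (simp_all add: gt_words_def lt_words_def collapse_eq_kept)

lemma Nil_gt [simp]: "[] \<in> gt_words"
  and Nil_lt [simp]: "[] \<in> lt_words"
  by (simp_all add: gt_words_def lt_words_def collapse_eq_kept)

end

section \<open>Runs of automata\<close>

context op_alphabet
begin

text \<open>A big step: all pops forced by \<open>b\<close> and the push or shift that reads it.
  Forgetting the states yields \<open>put\<close>.\<close>

fun opa_put :: "('a, 'q) opa \<Rightarrow> ('a \<Rightarrow> bool) \<Rightarrow> 'q \<Rightarrow> ('a \<times> 'q) list \<Rightarrow> 'a \<Rightarrow>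
    'q \<Rightarrow> ('a \<times> 'q) list \<Rightarrow> bool" where
  "opa_put M P s [] b t \<theta>' \<longleftrightarrow> P b \<and> (s, b, t) \<in> push_trans M \<and> \<theta>' = [(b, s)]"
| "opa_put M P s ((c, q) # \<theta>) b t \<theta>' \<longleftrightarrow>
     (if c \<rhd> b then \<exists>s'. (s, q, s') \<in> pop_trans M \<and> opa_put M P s' \<theta> b t \<theta>'
      else if c \<doteq> b then (s, b, t) \<in> shift_trans M \<and> \<theta>' = (b, q) # \<theta>
      else (s, b, t) \<in> push_trans M \<and> \<theta>' = (b, s) # (c, q) # \<theta>)"

fun opa_scan :: "('a, 'q) opa \<Rightarrow> ('a \<Rightarrow> bool) \<Rightarrow> 'q \<Rightarrow> ('a \<times> 'q) list \<Rightarrow> 'a list \<Rightarrow>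
    'q \<Rightarrow> ('a \<times> 'q) list \<Rightarrow> bool" where
  "opa_scan M P s \<theta> [] t \<theta>' \<longleftrightarrow> s = t \<and> \<theta> = \<theta>'"
| "opa_scan M P s \<theta> (b # w) t \<theta>' \<longleftrightarrow>
     (\<exists>s1 \<theta>1. opa_put M P s \<theta> b s1 \<theta>1 \<and> opa_scan M P s1 \<theta>1 w t \<theta>')"

fun opa_drain :: "('a, 'q) opa \<Rightarrow> 'a option \<Rightarrow> 'q \<Rightarrow> ('a \<times> 'q) list \<Rightarrow> 'q \<Rightarrow> bool" where
  "opa_drain M r s [] t \<longleftrightarrow> s = t"
| "opa_drain M r s ((c, q) # \<theta>) t \<longleftrightarrow>
     Some c \<rhd>\<^sub>\<epsilon> r \<and> (\<exists>s'. (s, q, s') \<in> pop_trans M \<and> opa_drain M r s' \<theta> t)"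

definition summary :: "('a, 'q) opa \<Rightarrow> 'a option \<Rightarrow> 'a list \<Rightarrow> 'a option \<Rightarrow> 'q \<Rightarrow> 'q \<Rightarrow> bool" where
  "summary M l w r s t \<longleftrightarrow>
     (\<exists>s' \<theta>. opa_scan M (above l) s [] w s' \<theta> \<and> opa_drain M r s' \<theta> t)"

definition finishes :: "('a, 'q) opa \<Rightarrow> 'a list \<Rightarrow> 'q \<Rightarrow> ('a \<times> 'q) list \<Rightarrow> 'q \<Rightarrow> bool" where
  "finishes M w s \<theta> t \<longleftrightarrow>
     (\<exists>s' \<theta>'. opa_scan M (\<lambda>_. True) s \<theta> w s' \<theta>' \<and> opa_drain M None s' \<theta>' t)"

lemma opa_put_fst: "opa_put M P s \<theta> b t \<theta>' \<Longrightarrow> put P (map fst \<theta>) b = Some (map fst \<theta>')"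
  by (induction M P s \<theta> b t \<theta>' rule: opa_put.induct) (auto split: if_splits)

lemma opa_scan_fst: "opa_scan M P s \<theta> w t \<theta>' \<Longrightarrow> scan P (map fst \<theta>) w = Some (map fst \<theta>')"
  by (induction M P s \<theta> w t \<theta>' rule: opa_scan.induct) (auto dest: opa_put_fst)

lemma opa_drain_fst: "opa_drain M r s \<theta> t \<Longrightarrow> c \<in> set (map fst \<theta>) \<Longrightarrow> Some c \<rhd>\<^sub>\<epsilon> r"
  by (induction M r s \<theta> t rule: opa_drain.induct) auto

lemma opa_scan_append:
  "opa_scan M P s \<theta> (v @ w) t \<theta>' \<longleftrightarrow>
    (\<exists>s1 \<theta>1. opa_scan M P s \<theta> v s1 \<theta>1 \<and> opa_scan M P s1 \<theta>1 w t \<theta>')"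
  by (induction v arbitrary: s \<theta>) auto

lemma opa_drain_append:
  "opa_drain M r s (\<theta> @ \<tau>) t \<longleftrightarrow> (\<exists>s'. opa_drain M r s \<theta> s' \<and> opa_drain M r s' \<tau> t)"
  by (induction \<theta> arbitrary: s) (auto, blast+)

text \<open>The stack letters alone determine the kind of each move, so with \<open>put Q\<close>
  defined no run can reach into \<open>\<tau>\<close>; this gives an equivalence.\<close>

lemma opa_put_frame:
  assumes "put Q (map fst \<theta>) b \<noteq> None" "supports P Q (map fst \<tau>)"
  shows "opa_put M P s (\<theta> @ \<tau>) b t \<theta>'' \<longleftrightarrow> (\<exists>\<theta>'. opa_put M Q s \<theta> b t \<theta>' \<and> \<theta>'' = \<theta>' @ \<tau>)"
  using assms(1)
proof (induction \<theta> arbitrary: s)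
  case Nil
  then show ?case
    using assms(2) by (cases \<tau>) (auto simp: supports_def lt_not_gt lt_not_eq split: if_splits)
next
  case (Cons x \<theta>)
  obtain c q where [simp]: "x = (c, q)" by (cases x)
  show ?case
  proof (cases "c \<rhd> b")
    case True
    then have "opa_put M P s1 (\<theta> @ \<tau>) b t \<theta>'' \<longleftrightarrow>
        (\<exists>\<theta>'. opa_put M Q s1 \<theta> b t \<theta>' \<and> \<theta>'' = \<theta>' @ \<tau>)" for s1
      using Cons by simp
    then show ?thesis using True by simp blast
  qed auto
qed

lemma opa_scan_frame:
  assumes "scan Q (map fst \<theta>) w \<noteq> None" "supports P Q (map fst \<tau>)"
  shows "opa_scan M P s (\<theta> @ \<tau>) w t \<theta>'' \<longleftrightarrow> (\<exists>\<theta>'. opa_scan M Q s \<theta> w t \<theta>' \<and> \<theta>'' = \<theta>' @ \<tau>)"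
  using assms(1)
proof (induction w arbitrary: s \<theta>)
  case (Cons b w)
  obtain \<sigma> where p: "put Q (map fst \<theta>) b = Some \<sigma>" and s: "scan Q \<sigma> w \<noteq> None"
    using Cons.prems by (cases "put Q (map fst \<theta>) b") auto
  have rest: "opa_scan M P s1 (\<theta>1 @ \<tau>) w t \<theta>'' \<longleftrightarrow>
      (\<exists>\<theta>'. opa_scan M Q s1 \<theta>1 w t \<theta>' \<and> \<theta>'' = \<theta>' @ \<tau>)"
    if "opa_put M Q s \<theta> b s1 \<theta>1" for s1 \<theta>1
    using Cons.IH[of \<theta>1] opa_put_fst[OF that] p s by simp
  have put: "opa_put M P s (\<theta> @ \<tau>) b s1 \<theta>1 \<longleftrightarrow>
      (\<exists>\<theta>'. opa_put M Q s \<theta> b s1 \<theta>' \<and> \<theta>1 = \<theta>' @ \<tau>)" for s1 \<theta>1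
    by (rule opa_put_frame) (use p assms(2) in auto)
  have "opa_scan M P s (\<theta> @ \<tau>) (b # w) t \<theta>'' \<longleftrightarrow>
      (\<exists>s1 \<theta>1. opa_put M Q s \<theta> b s1 \<theta>1 \<and> opa_scan M P s1 (\<theta>1 @ \<tau>) w t \<theta>'')"
    unfolding opa_scan.simps put by blast
  also have "\<dots> \<longleftrightarrow> (\<exists>\<theta>'. opa_scan M Q s \<theta> (b # w) t \<theta>' \<and> \<theta>'' = \<theta>' @ \<tau>)"
    unfolding opa_scan.simps using rest by (metis (no_types, opaque_lifting))
  finally show ?case .
qed auto

section \<open>Agreement with single steps\<close>

lemma opa_put_steps: "opa_put M (\<lambda>_. True) s \<theta> b t \<theta>' \<Longrightarrow> (step M)\<^sup>*\<^sup>* (s, b # w, \<theta>) (t, w, \<theta>')"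
proof (induction \<theta> arbitrary: s)
  case Nil
  then show ?case by (auto intro!: r_into_rtranclp step.push)
next
  case (Cons x \<theta>)
  obtain c q where [simp]: "x = (c, q)" by (cases x)
  consider "c \<rhd> b" | "c \<doteq> b" | "c \<lhd> b" using trichotomy by blast
  then show ?case
  proof cases
    case 1
    then obtain s' where s': "(s, q, s') \<in> pop_trans M" "opa_put M (\<lambda>_. True) s' \<theta> b t \<theta>'"
      using Cons.prems by auto
    have "step M (s, b # w, (c, q) # \<theta>) (s', b # w, \<theta>)"
      using 1 s' by (intro step.pop) (auto simp: first_letter_def)
    then show ?thesis using Cons.IH[OF s'(2)] by (simp add: converse_rtranclp_into_rtranclp)
  next
    case 2
    then show ?thesis using Cons.prems by (auto simp: eq_not_gt intro!: r_into_rtranclp step.shift)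
  next
    case 3
    then show ?thesis
      using Cons.prems by (auto simp: lt_not_gt lt_not_eq intro!: r_into_rtranclp step.push)
  qed
qed

lemma opa_scan_steps: "opa_scan M (\<lambda>_. True) s \<theta> w t \<theta>' \<Longrightarrow> (step M)\<^sup>*\<^sup>* (s, w, \<theta>) (t, [], \<theta>')"
  by (induction w arbitrary: s \<theta>) (auto intro: rtranclp_trans[OF opa_put_steps])

lemma opa_drain_steps: "opa_drain M None s \<theta> t \<Longrightarrow> (step M)\<^sup>*\<^sup>* (s, [], \<theta>) (t, [], [])"
proof (induction \<theta> arbitrary: s)
  case (Cons x \<theta>)
  then obtain s' where s': "(s, snd x, s') \<in> pop_trans M" "opa_drain M None s' \<theta> t"
    by (cases x) auto
  have "step M (s, [], (fst x, snd x) # \<theta>) (s', [], \<theta>)"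
    using s' by (intro step.pop) (auto simp: first_letter_def)
  then show ?case using Cons.IH[OF s'(2)] by (simp add: converse_rtranclp_into_rtranclp)
qed simp

lemma finishes_steps: "finishes M w s \<theta> t \<longleftrightarrow> (step M)\<^sup>*\<^sup>* (s, w, \<theta>) (t, [], [])"
proof
  assume "finishes M w s \<theta> t"
  then show "(step M)\<^sup>*\<^sup>* (s, w, \<theta>) (t, [], [])"
    unfolding finishes_def by (blast intro: rtranclp_trans[OF opa_scan_steps opa_drain_steps])
next
  assume "(step M)\<^sup>*\<^sup>* (s, w, \<theta>) (t, [], [])"
  then have "case (s, w, \<theta>) of (s, w, \<theta>) \<Rightarrow> finishes M w s \<theta> t"
  proof (induction rule: converse_rtranclp_induct)
    case base
    then show ?case by (simp add: finishes_def)
  next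
    case (step x y)
    from step.hyps(1) show ?case
    proof cases
      case (push \<theta> a s t' w)
      then have "opa_put M (\<lambda>_. True) s \<theta> a t' ((a, s) # \<theta>)"
        by (cases \<theta>) (auto simp: lt_not_gt lt_not_eq)
      then show ?thesis using step.IH push unfolding finishes_def by auto
    next
      case (shift b a s t' w q \<theta>)
      then have "opa_put M (\<lambda>_. True) s ((b, q) # \<theta>) a t' ((a, q) # \<theta>)"
        by (auto simp: eq_not_gt)
      then show ?thesis using step.IH shift unfolding finishes_def by fastforce
    next
      case (pop b w s q t' \<theta>)
      \<comment> \<open>A single pop belongs to the big step of the next letter or, at the end of
        the input, to the drain.\<close>
      show ?thesis
        using step.IH pop unfolding finishes_def
        by (cases w) (fastforce simp: first_letter_def)+
    qed
  qed
  then show "finishes M w s \<theta> t" by simp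
qed

lemma opa_language_iff:
  "w \<in> opa_language M \<longleftrightarrow> (\<exists>q\<^sub>0 \<in> initial M. \<exists>q\<^sub>F \<in> accepting M. finishes M w q\<^sub>0 [] q\<^sub>F)"
  by (simp add: opa_language_def finishes_steps)

lemma finishes_drain:
  assumes "\<And>c. c \<in> set (map fst \<sigma>) \<Longrightarrow> Some c \<rhd>\<^sub>\<epsilon> first_letter v"
  shows "finishes M v s (\<sigma> @ \<tau>) t \<longleftrightarrow>
    (\<exists>s'. opa_drain M (first_letter v) s \<sigma> s' \<and> finishes M v s' \<tau> t)"
  using assms
proof (induction \<sigma> arbitrary: s)
  case (Cons x \<sigma>)
  obtain c q where [simp]: "x = (c, q)" by (cases x)
  have "finishes M v s ((c, q) # \<sigma> @ \<tau>) t \<longleftrightarrow>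
      (\<exists>s'. (s, q, s') \<in> pop_trans M \<and> finishes M v s' (\<sigma> @ \<tau>) t)"
    using Cons.prems[of c] by (cases v) (simp_all add: finishes_def first_letter_def, blast)
  then show ?case using Cons by auto
qed simp

lemma finishes_append:
  "finishes M (v @ w) s \<theta> t \<longleftrightarrow>
    (\<exists>s' \<theta>'. opa_scan M (\<lambda>_. True) s \<theta> v s' \<theta>' \<and> finishes M w s' \<theta>' t)"
  by (auto simp: finishes_def opa_scan_append)

text \<open>Cuts a run at both ends of a chain body: the stack left by \<open>u\<close> is not
  touched while the body is read, and the right delimiter pops exactly what the body leaves.\<close>

lemma finishes_summary:
  assumes "chain_in u w v"
  shows "finishes M (u @ w @ v) q [] t \<longleftrightarrow>
    (\<exists>s \<tau> s'. opa_scan M (\<lambda>_. True) q [] u s \<tau> \<and>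
       summary M (last_letter u) w (first_letter v) s s' \<and> finishes M v s' \<tau> t)"
proof -
  let ?l = "last_letter u" and ?r = "first_letter v"
  obtain \<sigma> where \<sigma>: "scan (above ?l) [] w = Some \<sigma>" "\<And>c. c \<in> set \<sigma> \<Longrightarrow> Some c \<rhd>\<^sub>\<epsilon> ?r"
    using assms unfolding chain_in_def chain_iff_scan by blast
  have "finishes M (w @ v) s \<tau> t \<longleftrightarrow> (\<exists>s'. summary M ?l w ?r s s' \<and> finishes M v s' \<tau> t)"
    if "opa_scan M (\<lambda>_. True) q [] u s \<tau>" for s \<tau>
  proof -
    have "scan (\<lambda>_. True) [] u = Some (map fst \<tau>)" using opa_scan_fst[OF that] by simp
    then have "top_letter None (map fst \<tau>) = ?l"
      using scan_top_letter[of _ u _ None] by (auto simp: last_letter_def)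
    then have sup: "supports (\<lambda>_. True) (above ?l) (map fst \<tau>)"
      using supports_top[of None "map fst \<tau>"] by simp
    have "opa_scan M (\<lambda>_. True) s ([] @ \<tau>) w s1 \<theta>1 \<longleftrightarrow>
        (\<exists>\<theta>'. opa_scan M (above ?l) s [] w s1 \<theta>' \<and> \<theta>1 = \<theta>' @ \<tau>)" for s1 \<theta>1
      by (rule opa_scan_frame) (use \<sigma> sup in auto)
    moreover have "finishes M v s1 (\<theta>' @ \<tau>) t \<longleftrightarrow>
        (\<exists>s'. opa_drain M ?r s1 \<theta>' s' \<and> finishes M v s' \<tau> t)"
      if "opa_scan M (above ?l) s [] w s1 \<theta>'" for s1 \<theta>'
      by (rule finishes_drain) (use opa_scan_fst[OF that] \<sigma> in auto)
    ultimately show ?thesis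
      by (simp add: finishes_append summary_def) blast
  qed
  then show ?thesis unfolding finishes_append by blast
qed

text \<open>
  What a nonempty word \<open>x\<close> can do to an automaton when its first letter sits on top of an
  otherwise empty stack and the handle of its last letter is popped only after \<open>x\<close> has been read
  (with \<open>t\<close> the state after that pop): the admissible contexts of the congruences are exactly
  those that put \<open>x\<close> into this position.
\<close>

definition profile :: "('a, 'q) opa \<Rightarrow> 'a list \<Rightarrow>
    ('a option \<times> 'a option \<times> 'q \<times> 'q \<times> 'q \<times> 'q \<times> 'q \<times> 'q) set" where
  "profile M x = {(l, r, p, q, p', q', t, t').
     p \<in> states M \<and> q \<in> states M \<and> p' \<in> states M \<and> q' \<in> states M \<and> t \<in> states M \<and> t' \<in> states M \<and>
     (\<exists>\<theta>. opa_scan M (above l) p [(hd x, q)] (tl x) p' ((last x, q') # \<theta>) \<and> opa_drain M r t \<theta> t')}"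

lemma finite_profiles: "finite (states M) \<Longrightarrow> finite (range (profile M))"
  by (rule finite_subset[of _ "Pow (UNIV \<times> UNIV \<times> states M \<times> states M \<times> states M \<times> states M \<times>
        states M \<times> states M)"]) (auto simp: profile_def)

lemma opa_put_states:
  "opa_put M P s \<theta> b t \<theta>' \<Longrightarrow> opa M \<Longrightarrow> s \<in> states M \<Longrightarrow> snd ` set \<theta> \<subseteq> states M \<Longrightarrow>
    t \<in> states M \<and> snd ` set \<theta>' \<subseteq> states M"
proof (induction \<theta> arbitrary: s)
  case (Cons x \<theta>)
  obtain c q where [simp]: "x = (c, q)" by (cases x)
  show ?case
  proof (cases "c \<rhd> b")
    case True
    then obtain s' where s': "(s, q, s') \<in> pop_trans M" "opa_put M P s' \<theta> b t \<theta>'"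
      using Cons.prems(1) by auto
    have "s' \<in> states M" using s'(1) Cons.prems(2) by (auto simp: opa_def)
    then show ?thesis using Cons.IH[OF s'(2) Cons.prems(2)] Cons.prems(4) by simp
  next
    case False
    then show ?thesis using Cons.prems by (auto simp: opa_def split: if_splits)
  qed
qed (auto simp: opa_def)

lemma opa_scan_states:
  "opa_scan M P s \<theta> w t \<theta>' \<Longrightarrow> opa M \<Longrightarrow> s \<in> states M \<Longrightarrow> snd ` set \<theta> \<subseteq> states M \<Longrightarrow>
    t \<in> states M \<and> snd ` set \<theta>' \<subseteq> states M"
proof (induction w arbitrary: s \<theta>)
  case (Cons b w)
  then obtain s1 \<theta>1 where "opa_put M P s \<theta> b s1 \<theta>1" "opa_scan M P s1 \<theta>1 w t \<theta>'"
    using Cons.prems(1) by auto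
  then show ?case using Cons.IH Cons.prems(2) opa_put_states[OF _ Cons.prems(2-4)] by metis
qed simp

lemma opa_drain_states: "opa_drain M r s \<theta> t \<Longrightarrow> opa M \<Longrightarrow> s \<in> states M \<Longrightarrow> t \<in> states M"
proof (induction \<theta> arbitrary: s)
  case (Cons x \<theta>)
  then obtain s' where "(s, snd x, s') \<in> pop_trans M" "opa_drain M r s' \<theta> t"
    by (cases x) auto
  moreover from this(1) have "s' \<in> states M" using Cons.prems(2) by (auto simp: opa_def)
  ultimately show ?case using Cons.IH Cons.prems(2) by blast
qed simp

text \<open>Cuts the run behind the first and the last letter of \<open>x\<close>. The parts before
  and after mention \<open>x\<close> only through these two letters, so all else that matters is in
  \<open>profile\<close>.\<close>

lemma summary_profile:
  assumes "opa M" "s \<in> states M" "x \<noteq> []" "u\<^sub>0 @ [hd x] \<in> gt_words" "last x # v\<^sub>0 \<in> lt_words"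
  shows "summary M l (u\<^sub>0 @ x @ v\<^sub>0) r s t' \<longleftrightarrow>
    (\<exists>p q p' q' t s1 \<theta>1. opa_scan M (above l) s [] (u\<^sub>0 @ [hd x]) p [(hd x, q)] \<and>
       (l, r, p, q, p', q', t, t') \<in> profile M x \<and>
       opa_scan M (\<lambda>_. False) p' [(last x, q')] v\<^sub>0 s1 \<theta>1 \<and> opa_drain M r s1 \<theta>1 t)"
    (is "_ = ?rhs")
proof -
  have x: "u\<^sub>0 @ x @ v\<^sub>0 = (u\<^sub>0 @ [hd x]) @ tl x @ v\<^sub>0" using assms(3) by simp
  have split: "opa_scan M P s [] (u\<^sub>0 @ x @ v\<^sub>0) s1 \<theta>1 \<longleftrightarrow> (\<exists>p \<theta> p' \<theta>'.
      opa_scan M P s [] (u\<^sub>0 @ [hd x]) p \<theta> \<and> opa_scan M P p \<theta> (tl x) p' \<theta>' \<and>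
      opa_scan M P p' \<theta>' v\<^sub>0 s1 \<theta>1)" for P s1 \<theta>1
    unfolding x opa_scan_append[of M P s "[]" "u\<^sub>0 @ [hd x]"] opa_scan_append[of M P _ _ "tl x"]
    by blast
  \<comment> \<open>By \<open>lt_words_scan\<close>, \<open>v\<^sub>0\<close> leaves all below the
    handle of \<open>last x\<close> alone, so \<open>\<theta>\<close> is next touched in the final
    drain.\<close>
  have frame: "opa_scan M P p ((last x, q) # \<theta>) v\<^sub>0 s1 \<theta>1 \<longleftrightarrow>
      (\<exists>\<theta>'. opa_scan M (\<lambda>_. False) p [(last x, q)] v\<^sub>0 s1 \<theta>' \<and> \<theta>1 = \<theta>' @ \<theta>)" for P p q \<theta> s1 \<theta>1
    using opa_scan_frame[of "\<lambda>_. False" "[(last x, q)]" v\<^sub>0 P \<theta>] assms(5) lt_words_scan by simp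
  show ?thesis
  proof
    assume "summary M l (u\<^sub>0 @ x @ v\<^sub>0) r s t'"
    then obtain p \<theta> p' \<theta>' s1 \<theta>1 where run:
      "opa_scan M (above l) s [] (u\<^sub>0 @ [hd x]) p \<theta>" "opa_scan M (above l) p \<theta> (tl x) p' \<theta>'"
      "opa_scan M (above l) p' \<theta>' v\<^sub>0 s1 \<theta>1" "opa_drain M r s1 \<theta>1 t'"
      unfolding summary_def split by blast
    \<comment> \<open>By the \<open>gt_words\<close> condition nothing lies below
      \<open>hd x\<close>.\<close>
    have "map fst \<theta> = [hd x]"
      using gt_words_scan[OF assms(4)] opa_scan_fst[OF run(1)] by simp
    then obtain q where \<theta>: "\<theta> = [(hd x, q)]" by auto
    \<comment> \<open>Scanned from the very beginning, since \<open>tl x\<close> may be empty and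
      then shows nothing about the top.\<close>
    have "opa_scan M (above l) s [] (u\<^sub>0 @ x) p' \<theta>'"
      using run(1,2) assms(3) opa_scan_append[of M "above l" s "[]" "u\<^sub>0 @ [hd x]" "tl x"] by auto
    from opa_scan_fst[OF this] obtain \<sigma> where "map fst \<theta>' = last x # \<sigma>"
      using scan_top assms(3) by fastforce
    then obtain q' \<rho> where \<theta>': "\<theta>' = (last x, q') # \<rho>" by auto
    obtain \<theta>2 where \<theta>2: "opa_scan M (\<lambda>_. False) p' [(last x, q')] v\<^sub>0 s1 \<theta>2" "\<theta>1 = \<theta>2 @ \<rho>"
      using run(3) unfolding \<theta>' by (blast dest: frame[THEN iffD1])
    then obtain t where t: "opa_drain M r s1 \<theta>2 t" "opa_drain M r t \<rho> t'"
      using run(4) by (auto simp: opa_drain_append)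
    have st: "p \<in> states M" "q \<in> states M"
      using opa_scan_states[OF run(1) assms(1,2)] \<theta> by auto
    then have st': "p' \<in> states M" "q' \<in> states M"
      using opa_scan_states[OF run(2) assms(1)] \<theta> \<theta>' by auto
    then have "t \<in> states M"
      using opa_scan_states[OF \<theta>2(1) assms(1)] opa_drain_states[OF t(1) assms(1)] by auto
    then have "(l, r, p, q, p', q', t, t') \<in> profile M x"
      using st st' opa_drain_states[OF t(2) assms(1)] run(2) t(2) \<theta> \<theta>'
      by (auto simp: profile_def)
    then show ?rhs using run(1) \<theta>2(1) t(1) \<theta> by blast
  next
    assume ?rhs
    then obtain p q p' q' t s1 \<theta>1 \<theta> where run:
      "opa_scan M (above l) s [] (u\<^sub>0 @ [hd x]) p [(hd x, q)]"
      "opa_scan M (above l) p [(hd x, q)] (tl x) p' ((last x, q') # \<theta>)" "opa_drain M r t \<theta> t'"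
      "opa_scan M (\<lambda>_. False) p' [(last x, q')] v\<^sub>0 s1 \<theta>1" "opa_drain M r s1 \<theta>1 t"
      unfolding profile_def by blast
    have "opa_scan M (above l) p' ((last x, q') # \<theta>) v\<^sub>0 s1 (\<theta>1 @ \<theta>)"
      using run(4) by (blast intro: frame[THEN iffD2])
    moreover have "opa_drain M r s1 (\<theta>1 @ \<theta>) t'"
      using run(3,5) by (auto simp: opa_drain_append)
    ultimately show "summary M l (u\<^sub>0 @ x @ v\<^sub>0) r s t'"
      unfolding summary_def split using run(1,2) by blast
  qed
qed

lemma summary_profile_cong:
  assumes "opa M" "s \<in> states M" "x \<noteq> []" "y \<noteq> []" "hd x = hd y" "last x = last y"
    and "profile M x = profile M y" "u\<^sub>0 @ [hd x] \<in> gt_words" "last x # v\<^sub>0 \<in> lt_words"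
  shows "summary M l (u\<^sub>0 @ x @ v\<^sub>0) r s t \<longleftrightarrow> summary M l (u\<^sub>0 @ y @ v\<^sub>0) r s t"
  using summary_profile[of M s x u\<^sub>0 v\<^sub>0 l r t] summary_profile[of M s y u\<^sub>0 v\<^sub>0 l r t] assms by simp

section \<open>Automata without missing transitions\<close>

definition complete_opa :: "('a, 'q) opa \<Rightarrow> bool" where
  "complete_opa M \<longleftrightarrow> (\<forall>s \<in> states M.
     (\<forall>a. (\<exists>t. (s, a, t) \<in> push_trans M) \<and> (\<exists>t. (s, a, t) \<in> shift_trans M)) \<and>
     (\<forall>q \<in> states M. \<exists>t. (s, q, t) \<in> pop_trans M))"

text \<open>A run of such an automaton can be stopped only by the stack letters, that is, only where
  \<open>put\<close> fails.\<close>

lemma complete_opa_put: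
  assumes "opa M" "complete_opa M"
  shows "put P (map fst \<theta>) b \<noteq> None \<Longrightarrow> s \<in> states M \<Longrightarrow> snd ` set \<theta> \<subseteq> states M \<Longrightarrow>
    \<exists>t \<theta>'. opa_put M P s \<theta> b t \<theta>'"
proof (induction \<theta> arbitrary: s)
  case (Cons x \<theta>)
  obtain c q where [simp]: "x = (c, q)" by (cases x)
  show ?case
  proof (cases "c \<rhd> b")
    case True
    obtain s' where s': "(s, q, s') \<in> pop_trans M"
      using assms(2) Cons.prems(2,3) unfolding complete_opa_def by fastforce
    then have "s' \<in> states M" using assms(1) by (auto simp: opa_def)
    then have "\<exists>t \<theta>'. opa_put M P s' \<theta> b t \<theta>'" using Cons.IH[of s'] Cons.prems True by simp
    then show ?thesis using s' True by auto
  next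
    case False
    then show ?thesis
      using assms(2) Cons.prems(2) by (cases "c \<doteq> b") (auto simp: complete_opa_def)
  qed
next
  case Nil
  then obtain t where "(s, b, t) \<in> push_trans M" using assms(2) unfolding complete_opa_def by blast
  then have "opa_put M P s [] b t [(b, s)]" using Nil.prems(1) by (auto split: if_splits)
  then show ?case by blast
qed

lemma complete_opa_scan:
  assumes M: "opa M" "complete_opa M"
  shows "scan P (map fst \<theta>) w \<noteq> None \<Longrightarrow> s \<in> states M \<Longrightarrow> snd ` set \<theta> \<subseteq> states M \<Longrightarrow>
    \<exists>t \<theta>'. opa_scan M P s \<theta> w t \<theta>'"
proof (induction w arbitrary: s \<theta>)
  case (Cons b w)
  obtain \<sigma> where \<sigma>: "put P (map fst \<theta>) b = Some \<sigma>" "scan P \<sigma> w \<noteq> None"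
    using Cons.prems(1) by (cases "put P (map fst \<theta>) b") auto
  then obtain s1 \<theta>1 where p: "opa_put M P s \<theta> b s1 \<theta>1"
    using complete_opa_put[OF M _ Cons.prems(2,3), of P b] by auto
  then have "\<exists>t \<theta>'. opa_scan M P s1 \<theta>1 w t \<theta>'"
    using Cons.IH[of \<theta>1 s1] opa_put_fst[OF p] \<sigma> opa_put_states[OF p M(1) Cons.prems(2,3)] by simp
  then show ?case using p by auto
next
  case Nil
  have "opa_scan M P s \<theta> [] s \<theta>" by simp
  then show ?case by blast
qed

lemma complete_opa_drain:
  assumes "opa M" "complete_opa M"
  shows "\<forall>c \<in> set (map fst \<theta>). Some c \<rhd>\<^sub>\<epsilon> r \<Longrightarrow> s \<in> states M \<Longrightarrow> snd ` set \<theta> \<subseteq> states M \<Longrightarrow>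
    \<exists>t. opa_drain M r s \<theta> t"
proof (induction \<theta> arbitrary: s)
  case (Cons x \<theta>)
  obtain c q where [simp]: "x = (c, q)" by (cases x)
  obtain s' where s': "(s, q, s') \<in> pop_trans M"
    using assms(2) Cons.prems(2,3) unfolding complete_opa_def by fastforce
  then have "s' \<in> states M" using assms(1) by (auto simp: opa_def)
  then have "\<exists>t. opa_drain M r s' \<theta> t" using Cons.IH[of s'] Cons.prems by simp
  then show ?case using s' Cons.prems(1) by auto
qed auto

lemma chain_summary:
  assumes "opa M" "complete_opa M" "s \<in> states M" "chain l w r"
  shows "\<exists>t. summary M l w r s t"
proof -
  obtain \<sigma> where \<sigma>: "scan (above l) [] w = Some \<sigma>" "\<forall>c \<in> set \<sigma>. Some c \<rhd>\<^sub>\<epsilon> r"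
    using assms(4) by (auto simp: chain_iff_scan)
  then obtain s' \<theta> where \<theta>: "opa_scan M (above l) s [] w s' \<theta>"
    using complete_opa_scan[OF assms(1,2), of "above l" "[]" w s] assms(3) by auto
  then have "\<exists>t. opa_drain M r s' \<theta> t"
    using opa_scan_fst[OF \<theta>] \<sigma> opa_scan_states[OF \<theta> assms(1,3)]
    by (intro complete_opa_drain assms(1,2)) auto
  then show ?thesis using \<theta> by (auto simp: summary_def)
qed

definition full_opa :: "('a, unit) opa" where
  "full_opa = \<lparr> states = UNIV, initial = UNIV, accepting = UNIV,
     push_trans = UNIV, shift_trans = UNIV, pop_trans = UNIV \<rparr>"

lemma opa_full: "opa full_opa"
  by (simp add: opa_def full_opa_def)

lemma complete_full_opa: "complete_opa full_opa"
  by (simp add: complete_opa_def full_opa_def)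

text \<open>With one state and all transitions, a summary says no more than the scan. Being a chain
  becomes a fact about runs, so profiles apply to it too.\<close>

lemma chain_iff_summary: "chain l w r \<longleftrightarrow> w \<noteq> [] \<and> summary full_opa l w r () ()"
proof
  assume c: "chain l w r"
  have "\<exists>t. summary full_opa l w r () t"
    by (rule chain_summary[OF opa_full complete_full_opa _ c]) (simp add: full_opa_def)
  then show "w \<noteq> [] \<and> summary full_opa l w r () ()"
    using c by (auto simp: chain_iff_scan)
next
  assume "w \<noteq> [] \<and> summary full_opa l w r () ()"
  then obtain s \<theta> where \<theta>: "w \<noteq> []" "opa_scan full_opa (above l) () [] w s \<theta>"
    "opa_drain full_opa r s \<theta> ()"
    by (auto simp: summary_def)
  have "scan (above l) [] w = Some (map fst \<theta>)" using opa_scan_fst[OF \<theta>(2)] by simp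
  then show "chain l w r"
    unfolding chain_iff_scan using opa_drain_fst[OF \<theta>(3)] \<theta>(1) by blast
qed

end

section \<open>Recognized languages have finite index\<close>

context op_alphabet
begin

text \<open>Transports chain contexts and membership together, in one direction. The congruence is
  its symmetric part, so closure properties are proved for this relation and then used both
  ways.\<close>

definition half_congruent :: "'a list set \<Rightarrow> 'a list \<Rightarrow> 'a list \<Rightarrow> bool" where
  "half_congruent L x y \<longleftrightarrow>
     first_letter x = first_letter y \<and> last_letter x = last_letter y \<and>
     (\<forall>u v u\<^sub>0 v\<^sub>0. u\<^sub>0 @ word_of (first_letter x) \<in> gt_words \<longrightarrow>
        word_of (last_letter x) @ v\<^sub>0 \<in> lt_words \<longrightarrow> chain_in u (u\<^sub>0 @ x @ v\<^sub>0) v \<longrightarrow>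
        chain_in u (u\<^sub>0 @ y @ v\<^sub>0) v \<and> (u @ u\<^sub>0 @ x @ v\<^sub>0 @ v \<in> L \<longleftrightarrow> u @ u\<^sub>0 @ y @ v\<^sub>0 @ v \<in> L))"

lemma syntactic_congruence_iff_half:
  "(x, y) \<in> syntactic_congruence L \<longleftrightarrow> half_congruent L x y \<and> half_congruent L y x"
proof (cases "first_letter x = first_letter y \<and> last_letter x = last_letter y")
  case True
  then have e: "first_letter y = first_letter x" "last_letter y = last_letter x" by simp_all
  show ?thesis
    unfolding syntactic_congruence_def chain_equiv_def half_congruent_def e mem_Collect_eq case_prod_conv
    by blast
next
  case False
  then show ?thesis
    unfolding syntactic_congruence_def chain_equiv_def half_congruent_def by blast
qed

lemma half_congruent_trans:
  assumes xy: "half_congruent L x y" and yz: "half_congruent L y z"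
  shows "half_congruent L x z"
proof -
  have e: "first_letter x = first_letter y" "last_letter x = last_letter y"
    using xy unfolding half_congruent_def by blast+
  show ?thesis using xy yz unfolding half_congruent_def e by blast
qed

lemma half_congruent_refl: "half_congruent L x x"
  by (simp add: half_congruent_def)

lemma equiv_syntactic_congruence: "equiv UNIV (syntactic_congruence L)"
proof (rule equivI)
  show "refl (syntactic_congruence L)"
    by (simp add: refl_on_def syntactic_congruence_iff_half half_congruent_refl)
  show "sym (syntactic_congruence L)"
    by (simp add: sym_def syntactic_congruence_iff_half)
  show "trans (syntactic_congruence L)"
    unfolding trans_def syntactic_congruence_iff_half by (blast intro: half_congruent_trans)
qed simp

text \<open>In an admissible context, profiles determine summaries: those of \<open>full_opa\<close>
  transport the chain, those of \<open>M\<close> the acceptance.\<close>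

lemma half_congruent_profile:
  assumes M: "opa M" and xy: "first_letter x = first_letter y" "last_letter x = last_letter y"
    and "profile M x = profile M y" "profile full_opa x = profile full_opa y"
  shows "half_congruent (opa_language M) x y"
proof (cases "x = []")
  case True
  then show ?thesis using xy by (auto simp: half_congruent_def first_letter_def split: if_splits)
next
  case False
  then have x: "x \<noteq> []" "y \<noteq> []" "hd x = hd y" "last x = last y"
    using xy by (auto simp: first_letter_def last_letter_def split: if_splits)
  have words: "word_of (first_letter x) = [hd x]" "word_of (last_letter x) = [last x]"
    using x by (simp_all add: first_letter_def last_letter_def)
  have key: "chain_in u (u\<^sub>0 @ y @ v\<^sub>0) v \<and>
      (u @ u\<^sub>0 @ x @ v\<^sub>0 @ v \<in> opa_language M \<longleftrightarrow> u @ u\<^sub>0 @ y @ v\<^sub>0 @ v \<in> opa_language M)"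
    if "u\<^sub>0 @ [hd x] \<in> gt_words" "[last x] @ v\<^sub>0 \<in> lt_words" "chain_in u (u\<^sub>0 @ x @ v\<^sub>0) v"
    for u v u\<^sub>0 v\<^sub>0
  proof
    have c: "u\<^sub>0 @ [hd x] \<in> gt_words" "last x # v\<^sub>0 \<in> lt_words" "chain_in u (u\<^sub>0 @ x @ v\<^sub>0) v"
      using that by simp_all
    let ?l = "last_letter u" and ?r = "first_letter v"
    show cy: "chain_in u (u\<^sub>0 @ y @ v\<^sub>0) v"
      using c(3) summary_profile_cong[OF opa_full _ x assms(5) c(1,2)] x
      by (simp add: chain_in_def chain_iff_summary full_opa_def)
    have "finishes M (u @ (u\<^sub>0 @ x @ v\<^sub>0) @ v) q [] t \<longleftrightarrow> finishes M (u @ (u\<^sub>0 @ y @ v\<^sub>0) @ v) q [] t"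
      if q: "q \<in> initial M" for q t
    proof -
      have "s \<in> states M" if "opa_scan M (\<lambda>_. True) q [] u s \<tau>" for s \<tau>
        using opa_scan_states[OF that M] q M by (auto simp: opa_def)
      then show ?thesis
        unfolding finishes_summary[OF c(3)] finishes_summary[OF cy]
        using summary_profile_cong[OF M _ x assms(4) c(1,2), of _ ?l ?r] by blast
    qed
    then show "u @ u\<^sub>0 @ x @ v\<^sub>0 @ v \<in> opa_language M \<longleftrightarrow> u @ u\<^sub>0 @ y @ v\<^sub>0 @ v \<in> opa_language M"
      by (simp add: opa_language_iff)
  qed
  show ?thesis
    unfolding half_congruent_def words using xy key by blast
qed

lemma finite_quotient_if_finite_range:
  assumes "equiv UNIV R" "finite (range f)" "\<And>x y. f x = f y \<Longrightarrow> (x, y) \<in> R"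
  shows "finite (UNIV // R)"
proof (rule finite_subset)
  show "UNIV // R \<subseteq> (\<lambda>k. R `` {inv f k}) ` range f"
  proof
    fix X assume "X \<in> UNIV // R"
    then obtain x where X: "X = R `` {x}" by (auto simp: quotient_def)
    have "f (inv f (f x)) = f x" by (simp add: f_inv_into_f)
    then have "R `` {inv f (f x)} = R `` {x}"
      using assms(3) equiv_class_eq[OF assms(1)] by blast
    then show "X \<in> (\<lambda>k. R `` {inv f k}) ` range f" using X by blast
  qed
qed (use assms(2) in simp)

lemma finite_index_opa_language:
  assumes M: "opa M"
  shows "finite (UNIV // syntactic_congruence (opa_language M))"
proof (rule finite_quotient_if_finite_range[OF equiv_syntactic_congruence])
  let ?f = "\<lambda>x. ((first_letter x, last_letter x), profile M x, profile full_opa x)"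
  have "finite ((UNIV :: ('a option \<times> 'a option) set) \<times> range (profile M) \<times> range (profile full_opa))"
    using finite_profiles[of M] finite_profiles[of full_opa] M opa_full
    by (intro finite_cartesian_product) (auto simp: opa_def)
  then show "finite (range ?f)" by (rule finite_subset[rotated]) auto
  show "(x, y) \<in> syntactic_congruence (opa_language M)" if "?f x = ?f y" for x y
    using that half_congruent_profile[OF M] by (simp add: syntactic_congruence_iff_half)
qed

end

section \<open>The automaton of the syntactic congruence\<close>

context op_alphabet
begin

lemma half_congruentI:
  assumes "first_letter x = first_letter y" "last_letter x = last_letter y"
    and "\<And>u v u\<^sub>0 v\<^sub>0. u\<^sub>0 @ word_of (first_letter x) \<in> gt_words \<Longrightarrow>
      word_of (last_letter x) @ v\<^sub>0 \<in> lt_words \<Longrightarrow> chain_in u (u\<^sub>0 @ x @ v\<^sub>0) v \<Longrightarrow>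
      chain_in u (u\<^sub>0 @ y @ v\<^sub>0) v \<and> (u @ u\<^sub>0 @ x @ v\<^sub>0 @ v \<in> L \<longleftrightarrow> u @ u\<^sub>0 @ y @ v\<^sub>0 @ v \<in> L)"
  shows "half_congruent L x y"
  unfolding half_congruent_def
  by (rule conjI[OF assms(1) conjI[OF assms(2)]]) (intro allI impI, rule assms(3))

lemma syntactic_congruenceD:
  assumes "(x, y) \<in> syntactic_congruence L" "u\<^sub>0 @ word_of (first_letter x) \<in> gt_words"
    and "word_of (last_letter x) @ v\<^sub>0 \<in> lt_words" "chain_in u (u\<^sub>0 @ x @ v\<^sub>0) v"
  shows "chain_in u (u\<^sub>0 @ y @ v\<^sub>0) v" "u @ u\<^sub>0 @ x @ v\<^sub>0 @ v \<in> L \<longleftrightarrow> u @ u\<^sub>0 @ y @ v\<^sub>0 @ v \<in> L"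
proof -
  have "half_congruent L x y" using assms(1) by (simp add: syntactic_congruence_iff_half)
  from this[unfolded half_congruent_def, THEN conjunct2, THEN conjunct2, rule_format, OF assms(2-4)]
  show "chain_in u (u\<^sub>0 @ y @ v\<^sub>0) v" "u @ u\<^sub>0 @ x @ v\<^sub>0 @ v \<in> L \<longleftrightarrow> u @ u\<^sub>0 @ y @ v\<^sub>0 @ v \<in> L"
    by (rule conjunct1, rule conjunct2)
qed

lemma syntactic_congruence_sym:
  "(x, y) \<in> syntactic_congruence L \<Longrightarrow> (y, x) \<in> syntactic_congruence L"
  by (simp add: syntactic_congruence_iff_half)

lemma syntactic_congruence_refl: "(x, x) \<in> syntactic_congruence L"
  using equiv_syntactic_congruence[of L] by (auto simp: equiv_def refl_on_def)

lemma syntactic_congruence_ends: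
  assumes "(x, y) \<in> syntactic_congruence L"
  shows "first_letter x = first_letter y" "last_letter x = last_letter y"
  using assms unfolding syntactic_congruence_iff_half half_congruent_def by blast+

lemma syntactic_congruence_Nil: "(x, y) \<in> syntactic_congruence L \<Longrightarrow> x = [] \<longleftrightarrow> y = []"
  using syntactic_congruence_ends(1)[of x y L] by (auto simp: first_letter_def split: if_splits)

lemma letters_simps [simp]:
  "first_letter [] = None" "last_letter [] = None"
  "first_letter (a # w) = Some a" "last_letter (w @ [a]) = Some a" "last_letter [a] = Some a"
  by (simp_all add: first_letter_def last_letter_def)

lemma letter_word_of [simp]: "first_letter (word_of l) = l" "last_letter (word_of l) = l"
  by (cases l; simp)+

lemma first_letter_append: "first_letter (v @ w) = (if v = [] then first_letter w else first_letter v)"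
  and last_letter_append: "last_letter (v @ w) = (if w = [] then last_letter v else last_letter w)"
  by (auto simp: first_letter_def last_letter_def)

lemma word_of_letters [simp]:
  "w \<noteq> [] \<Longrightarrow> word_of (first_letter w) = [hd w]" "w \<noteq> [] \<Longrightarrow> word_of (last_letter w) = [last w]"
  by (simp_all add: first_letter_def last_letter_def)

lemma word_of_gt_lt [simp]: "word_of l \<in> gt_words" "word_of l \<in> lt_words"
  by (cases l; simp)+

lemma chain_congruent:
  assumes "(z, z') \<in> syntactic_congruence L" "chain l z r"
  shows "chain l z' r"
proof -
  \<comment> \<open>The delimiters themselves serve as outer words, with empty
    \<open>u\<^sub>0\<close> and \<open>v\<^sub>0\<close>.\<close>
  have "chain_in (word_of l) ([] @ z @ []) (word_of r)" using assms(2) by (simp add: chain_in_def)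
  from syntactic_congruenceD(1)[OF assms(1) _ _ this] show ?thesis by (simp add: chain_in_def)
qed

lemma chain_None_None: "w \<noteq> [] \<Longrightarrow> chain None w None"
proof -
  have "put (\<lambda>_. True) \<sigma> b \<noteq> None" for \<sigma> b by (induction \<sigma>) auto
  then have "scan (\<lambda>_. True) \<sigma> w \<noteq> None" for \<sigma>
    by (induction w arbitrary: \<sigma>) (auto split: option.splits)
  then show "w \<noteq> [] \<Longrightarrow> chain None w None" by (auto simp: chain_iff_scan)
qed

text \<open>\<open>L\<close> is a union of classes, because the empty context is admissible for
  every nonempty word by \<open>chain_None_None\<close>.\<close>

lemma syntactic_congruence_member:
  assumes "(x, y) \<in> syntactic_congruence L"
  shows "x \<in> L \<longleftrightarrow> y \<in> L"
proof (cases "x = []")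
  case True
  then show ?thesis using syntactic_congruence_Nil[OF assms] by simp
next
  case False
  then have "chain_in [] ([] @ x @ []) []" by (simp add: chain_in_def chain_None_None)
  from syntactic_congruenceD(2)[OF assms _ _ this] show ?thesis by simp
qed

text \<open>What \<open>z\<close> leaves on the stack is popped by \<open>b\<close>. If the scan of
  \<open>p\<close> fails, neither side holds.\<close>

lemma chain_in_skip:
  assumes "z = [] \<or> chain_in (u @ p) z (b # w @ v)"
  shows "chain_in u (p @ z @ b # w) v \<longleftrightarrow> chain_in u (p @ b # w) v"
proof (cases "scan (above (last_letter u)) [] p")
  case (Some \<tau>)
  then have "top_letter (last_letter u) \<tau> = last_letter (u @ p)"
    using scan_top_letter[OF Some, of "last_letter u"] by (simp add: last_letter_append)
  then have "supports (above (last_letter u)) (above (last_letter (u @ p))) \<tau>"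
    using supports_top[of "last_letter u" \<tau>] by simp
  then show ?thesis
    using scan_skip_chain[of z "last_letter (u @ p)" b _ \<tau> w] assms Some
    by (simp add: chain_in_def chain_iff_scan scan_append)
qed (simp add: chain_in_def chain_iff_scan scan_append)

lemma chain_in_skip_end:
  assumes "z = [] \<or> chain_in (u @ p) z v" "p \<noteq> []"
  shows "chain_in u (p @ z) v \<longleftrightarrow> chain_in u p v"
proof (cases "scan (above (last_letter u)) [] p")
  case (Some \<tau>)
  then have "top_letter (last_letter u) \<tau> = last_letter (u @ p)"
    using scan_top_letter[OF Some, of "last_letter u"] by (simp add: last_letter_append)
  then have "supports (above (last_letter u)) (above (last_letter (u @ p))) \<tau>"
    using supports_top[of "last_letter u" \<tau>] by simp
  from scan_chain[OF _ this, of z "first_letter v"] obtain \<sigma>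
    where "scan (above (last_letter u)) \<tau> z = Some (\<sigma> @ \<tau>)"
      "\<forall>c \<in> set \<sigma>. Some c \<rhd>\<^sub>\<epsilon> first_letter v"
    using assms(1) unfolding chain_in_def by blast
  then show ?thesis
    using Some assms(2) by (auto simp: chain_in_def chain_iff_scan scan_append)
qed (simp add: chain_in_def chain_iff_scan scan_append)

text \<open>
  In an admissible context of \<open>z a\<close> the word \<open>z\<close> starts with a bare stack, so it behaves there as
  it does between \<open>l\<close> and \<open>a\<close>; everything read so far is popped when \<open>a\<close> is reached.
\<close>

lemma chain_prefix:
  assumes "chain_in u (u\<^sub>0 @ z @ a # v\<^sub>0) v" "u\<^sub>0 @ [hd z] \<in> gt_words" "chain l z (Some a)"
  shows "chain_in u (u\<^sub>0 @ z) (a # v\<^sub>0 @ v)"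
proof -
  let ?l = "last_letter u"
  obtain d z1 where z: "z = d # z1" using assms(3) by (cases z) (auto simp: chain_iff_scan)
  obtain \<sigma>0 \<sigma>1 where s: "scan (above ?l) [] (u\<^sub>0 @ [d]) = Some \<sigma>0" "scan (above ?l) \<sigma>0 z1 = Some \<sigma>1"
    using assms(1) scan_append[of "above ?l" "[]" "u\<^sub>0 @ [d]" "z1 @ a # v\<^sub>0"]
    by (auto simp: z chain_in_def chain_iff_scan scan_append split: option.splits)
  have \<sigma>0: "\<sigma>0 = [d]" using gt_words_scan[OF _ s(1)] assms(2) z by simp
  obtain \<sigma> where \<sigma>: "scan (above l) [d] z1 = Some \<sigma>" "\<forall>c \<in> set \<sigma>. c \<rhd> a"
    using assms(3) by (auto simp: z chain_iff_scan split: if_splits)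
  \<comment> \<open>Both scans of \<open>z1\<close> start from \<open>[d]\<close>, so under the
    permissive predicate they agree.\<close>
  have "\<sigma> = \<sigma>1" using scan_True[OF s(2)] scan_True[OF \<sigma>(1)] \<sigma>0 by simp
  moreover have "scan (above ?l) [] (u\<^sub>0 @ z) = Some \<sigma>1"
    using scan_append[of "above ?l" "[]" "u\<^sub>0 @ [d]" z1] s by (simp add: z)
  ultimately show ?thesis using \<sigma>(2) z by (auto simp: chain_in_def chain_iff_scan)
qed

section \<open>Compatibility with push, shift and pop\<close>

lemma half_congruent_push:
  assumes "(z, z') \<in> syntactic_congruence L" "z = [] \<or> chain l z (Some a)"
  shows "half_congruent L (z @ [a]) (z' @ [a])"
proof (cases "z = []")
  case True
  then show ?thesis
    using syntactic_congruence_Nil[OF assms(1)] by (simp add: half_congruent_def)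
next
  case False
  note ends = syntactic_congruence_ends[OF assms(1)]
  have z': "z' \<noteq> []" using False syntactic_congruence_Nil[OF assms(1)] by simp
  show ?thesis
  proof (rule half_congruentI)
    fix u v u\<^sub>0 v\<^sub>0
    assume c: "u\<^sub>0 @ word_of (first_letter (z @ [a])) \<in> gt_words"
      "chain_in u (u\<^sub>0 @ (z @ [a]) @ v\<^sub>0) v"
    then have gt: "u\<^sub>0 @ word_of (first_letter z) \<in> gt_words"
      using False by (simp add: first_letter_append)
    \<comment> \<open>The letter \<open>a\<close> moves to the right outer word: the congruence of
      \<open>z\<close> is applied to a shorter body, with \<open>[]\<close> for
      \<open>v\<^sub>0\<close>.\<close>
    have pre: "chain_in u (u\<^sub>0 @ z @ []) (a # v\<^sub>0 @ v)"
      using chain_prefix[of u u\<^sub>0 z a v\<^sub>0 v l] c(2) gt assms(2) False by simp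
    have pre': "chain_in u (u\<^sub>0 @ z') (a # v\<^sub>0 @ v)"
      using syntactic_congruenceD(1)[OF assms(1) gt _ pre] by simp
    \<comment> \<open>In front of \<open>a\<close> both \<open>u\<^sub>0 @ z\<close> and
      \<open>u\<^sub>0 @ z'\<close> can be skipped, so the two long bodies are chains under the same
      condition on \<open>a # v\<^sub>0\<close>.\<close>
    have "chain_in u ([] @ (u\<^sub>0 @ z') @ a # v\<^sub>0) v"
      using chain_in_skip[of "u\<^sub>0 @ z'" u "[]" a v\<^sub>0 v] chain_in_skip[of "u\<^sub>0 @ z" u "[]" a v\<^sub>0 v]
        pre pre' c(2) by simp
    then show "chain_in u (u\<^sub>0 @ (z' @ [a]) @ v\<^sub>0) v \<and>
        (u @ u\<^sub>0 @ (z @ [a]) @ v\<^sub>0 @ v \<in> L \<longleftrightarrow> u @ u\<^sub>0 @ (z' @ [a]) @ v\<^sub>0 @ v \<in> L)"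
      using syntactic_congruenceD(2)[OF assms(1) gt _ pre] by simp
  qed (use ends False z' in \<open>simp_all add: first_letter_append\<close>)
qed

lemma congruent_push:
  assumes "(z, z') \<in> syntactic_congruence L" "z = [] \<or> chain l z (Some a)"
  shows "(z @ [a], z' @ [a]) \<in> syntactic_congruence L"
proof -
  have "z' = [] \<or> chain l z' (Some a)"
    using assms chain_congruent syntactic_congruence_Nil by blast
  then show ?thesis
    using assms half_congruent_push syntactic_congruence_sym
    unfolding syntactic_congruence_iff_half[of "z @ [a]"] by blast
qed

lemma lt_words_shift:
  assumes "z = [] \<or> chain (Some c) z (Some a)" "c \<doteq> a" "a # v \<in> lt_words"
  shows "c # z @ a # v \<in> lt_words"
  using scan_skip_chain[OF assms(1), of "\<lambda>_. False" "[c]" v] assms(2,3)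
  by (auto simp: lt_words_scan eq_not_gt)

text \<open>\<open>z @ a # v\<^sub>0\<close> takes the place of \<open>v\<^sub>0\<close> in the
  context of \<open>y\<close>: \<open>z\<close> is skipped, \<open>a\<close> extends the handle of
  \<open>last y\<close>, and the old \<open>v\<^sub>0\<close> does not pop it.\<close>

lemma half_congruent_shift_left:
  assumes "(y, y') \<in> syntactic_congruence L" "y \<noteq> []" "last y \<doteq> a"
    and z: "z = [] \<or> chain (Some (last y)) z (Some a)"
  shows "half_congruent L (y @ z @ [a]) (y' @ z @ [a])"
proof (rule half_congruentI)
  have y': "y' \<noteq> []" using assms(1,2) syntactic_congruence_Nil by blast
  show "first_letter (y @ z @ [a]) = first_letter (y' @ z @ [a])"
    "last_letter (y @ z @ [a]) = last_letter (y' @ z @ [a])"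
    using syntactic_congruence_ends[OF assms(1)] assms(2) y'
    by (simp_all add: first_letter_append last_letter_append)
  fix u v u\<^sub>0 v\<^sub>0
  assume c: "u\<^sub>0 @ word_of (first_letter (y @ z @ [a])) \<in> gt_words"
    "word_of (last_letter (y @ z @ [a])) @ v\<^sub>0 \<in> lt_words"
    "chain_in u (u\<^sub>0 @ (y @ z @ [a]) @ v\<^sub>0) v"
  have "word_of (last_letter y) @ z @ a # v\<^sub>0 \<in> lt_words"
    using lt_words_shift[OF z assms(3)] c(2) assms(2) by (simp add: last_letter_append)
  moreover have "u\<^sub>0 @ word_of (first_letter y) \<in> gt_words"
    using c(1) assms(2) by (simp add: first_letter_append)
  ultimately show "chain_in u (u\<^sub>0 @ (y' @ z @ [a]) @ v\<^sub>0) v \<and>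
      (u @ u\<^sub>0 @ (y @ z @ [a]) @ v\<^sub>0 @ v \<in> L \<longleftrightarrow> u @ u\<^sub>0 @ (y' @ z @ [a]) @ v\<^sub>0 @ v \<in> L)"
    using syntactic_congruenceD[OF assms(1), of u\<^sub>0 "z @ a # v\<^sub>0" u v] c(3) by simp
qed

text \<open>Here \<open>z\<close> is a chain by itself, so its context has empty
  \<open>u\<^sub>0\<close> and \<open>v\<^sub>0\<close>, and \<open>y\<close> belongs to the left
  outer word.\<close>

lemma half_congruent_shift_right:
  assumes "(z, z') \<in> syntactic_congruence L" "y \<noteq> []" "chain (Some (last y)) z (Some a)"
  shows "half_congruent L (y @ z @ [a]) (y @ z' @ [a])"
proof (rule half_congruentI)
  fix u v u\<^sub>0 v\<^sub>0
  assume c: "chain_in u (u\<^sub>0 @ (y @ z @ [a]) @ v\<^sub>0) v"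
  have last: "last_letter (u @ u\<^sub>0 @ y) = Some (last y)"
    using assms(2) by (simp add: last_letter_def)
  have z: "chain_in (u @ u\<^sub>0 @ y) ([] @ z @ []) (a # v\<^sub>0 @ v)"
    using assms(3) last by (simp add: chain_in_def)
  note zz = syntactic_congruenceD[OF assms(1) _ _ z]
  have "chain_in u ((u\<^sub>0 @ y) @ z' @ a # v\<^sub>0) v"
    using chain_in_skip[of z u "u\<^sub>0 @ y" a v\<^sub>0 v] chain_in_skip[of z' u "u\<^sub>0 @ y" a v\<^sub>0 v] z zz(1) c
    by simp
  then show "chain_in u (u\<^sub>0 @ (y @ z' @ [a]) @ v\<^sub>0) v \<and>
      (u @ u\<^sub>0 @ (y @ z @ [a]) @ v\<^sub>0 @ v \<in> L \<longleftrightarrow> u @ u\<^sub>0 @ (y @ z' @ [a]) @ v\<^sub>0 @ v \<in> L)"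
    using zz(2) by simp
qed (use assms(2) in \<open>simp_all add: first_letter_append last_letter_append\<close>)

lemma half_congruent_shift:
  assumes "(y, y') \<in> syntactic_congruence L" "(z, z') \<in> syntactic_congruence L"
    and "y \<noteq> []" "last y \<doteq> a" "z = [] \<or> chain (Some (last y)) z (Some a)"
  shows "half_congruent L (y @ z @ [a]) (y' @ z' @ [a])"
proof -
  have y': "y' \<noteq> []" "last y' = last y"
    using assms(1,3) syntactic_congruence_Nil[OF assms(1)] syntactic_congruence_ends(2)[OF assms(1)]
    by (auto simp: last_letter_def)
  have "half_congruent L (y' @ z @ [a]) (y' @ z' @ [a])"
    using half_congruent_shift_right[OF assms(2) y'(1), of a] y'(2) assms(5)
      syntactic_congruence_Nil[OF assms(2)] half_congruent_refl by (cases "z = []") simp_all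
  then show ?thesis
    using half_congruent_shift_left[OF assms(1,3-5)] half_congruent_trans by blast
qed

lemma lt_words_pop:
  assumes "chain (Some c) z r" "last z # v \<in> lt_words"
  shows "c # z @ v \<in> lt_words"
proof -
  obtain \<sigma> where \<sigma>: "z \<noteq> []" "scan (above (Some c)) [] z = Some \<sigma>"
    using assms(1) by (auto simp: chain_iff_scan)
  then obtain \<sigma>' where \<sigma>': "\<sigma> = last z # \<sigma>'" using scan_top by blast
  obtain \<rho> where \<rho>: "scan (\<lambda>_. False) [last z] v = Some \<rho>"
    using assms(2) by (auto simp: lt_words_scan)
  show ?thesis
    using scan_frame[OF \<sigma>(2), of "\<lambda>_. False" "[c]"] scan_frame[OF \<rho>, of "\<lambda>_. False" "\<sigma>' @ [c]"]
    by (simp add: lt_words_scan scan_append \<sigma>')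
qed

lemma half_congruent_pop_left:
  assumes "(y, y') \<in> syntactic_congruence L" "y \<noteq> []" "z = [] \<or> chain (Some (last y)) z r"
  shows "half_congruent L (y @ z) (y' @ z)"
proof (rule half_congruentI)
  have y': "y' \<noteq> []" using assms(1,2) syntactic_congruence_Nil by blast
  show "first_letter (y @ z) = first_letter (y' @ z)" "last_letter (y @ z) = last_letter (y' @ z)"
    using syntactic_congruence_ends[OF assms(1)] assms(2) y'
    by (simp_all add: first_letter_append last_letter_append)
  fix u v u\<^sub>0 v\<^sub>0
  assume c: "u\<^sub>0 @ word_of (first_letter (y @ z)) \<in> gt_words"
    "word_of (last_letter (y @ z)) @ v\<^sub>0 \<in> lt_words" "chain_in u (u\<^sub>0 @ (y @ z) @ v\<^sub>0) v"
  have "word_of (last_letter y) @ z @ v\<^sub>0 \<in> lt_words"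
    using lt_words_pop[of "last y" z r v\<^sub>0] c(2) assms(2,3)
    by (cases "z = []") (auto simp: last_letter_append)
  moreover have "u\<^sub>0 @ word_of (first_letter y) \<in> gt_words"
    using c(1) assms(2) by (simp add: first_letter_append)
  ultimately show "chain_in u (u\<^sub>0 @ (y' @ z) @ v\<^sub>0) v \<and>
      (u @ u\<^sub>0 @ (y @ z) @ v\<^sub>0 @ v \<in> L \<longleftrightarrow> u @ u\<^sub>0 @ (y' @ z) @ v\<^sub>0 @ v \<in> L)"
    using syntactic_congruenceD[OF assms(1), of u\<^sub>0 "z @ v\<^sub>0" u v] c(3) by simp
qed

text \<open>\<open>z\<close> and \<open>v\<^sub>0\<close> never reach below themselves, so they
  leave the same letters over the delimiter \<open>last p\<close> as over the full stack of
  \<open>p\<close>; the right delimiter pops these in the longer chain already.\<close>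

lemma chain_suffix:
  assumes "chain_in u (p @ z @ v\<^sub>0) v" "p \<noteq> []" "chain (Some (last p)) z r" "last z # v\<^sub>0 \<in> lt_words"
  shows "chain_in (u @ p) (z @ v\<^sub>0) v"
proof -
  let ?l = "last_letter u"
  obtain \<sigma> where \<sigma>: "z \<noteq> []" "scan (above (Some (last p))) [] z = Some \<sigma>"
    using assms(3) by (auto simp: chain_iff_scan)
  then obtain \<sigma>' where \<sigma>': "\<sigma> = last z # \<sigma>'" using scan_top by blast
  obtain \<rho> where \<rho>: "scan (\<lambda>_. False) [last z] v\<^sub>0 = Some \<rho>"
    using assms(4) by (auto simp: lt_words_scan)
  obtain \<tau>0 where "scan (above ?l) [] p = Some \<tau>0"
    using assms(1) by (auto simp: chain_in_def chain_iff_scan scan_append split: option.splits)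
  then obtain \<tau> where \<tau>: "scan (above ?l) [] p = Some (last p # \<tau>)"
    using scan_top assms(2) by blast
  have "scan (above ?l) (last p # \<tau>) z = Some (last z # \<sigma>' @ last p # \<tau>)"
    using scan_frame[OF \<sigma>(2), of "above ?l" "last p # \<tau>"] \<sigma>' by simp
  moreover have "scan (above ?l) (last z # \<sigma>' @ last p # \<tau>) v\<^sub>0 = Some (\<rho> @ \<sigma>' @ last p # \<tau>)"
    using scan_frame[OF \<rho>, of "above ?l" "\<sigma>' @ last p # \<tau>"] by simp
  ultimately have "\<forall>c \<in> set (\<rho> @ \<sigma>'). Some c \<rhd>\<^sub>\<epsilon> first_letter v"
    using assms(1) \<tau> by (auto simp: chain_in_def chain_iff_scan scan_append)
  moreover have "scan (above (Some (last p))) [] (z @ v\<^sub>0) = Some (\<rho> @ \<sigma>')"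
    using scan_frame[OF \<rho>, of "above (Some (last p))" \<sigma>'] \<sigma> \<sigma>' by (simp add: scan_append)
  ultimately show ?thesis
    using \<sigma>(1) assms(2) by (auto simp: chain_in_def chain_iff_scan last_letter_def)
qed

text \<open>Unlike for a shift, the text after \<open>z\<close> may extend its last handle, so
  \<open>v\<^sub>0\<close> stays with \<open>z\<close> and only \<open>u\<^sub>0 @ y\<close> moves
  to the outer word; \<open>chain_suffix\<close> justifies this.\<close>

lemma half_congruent_pop_right:
  assumes "(z, z') \<in> syntactic_congruence L" "y \<noteq> []" "chain (Some (last y)) z r"
  shows "half_congruent L (y @ z) (y @ z')"
proof -
  have z: "z \<noteq> []" using assms(3) by (auto simp: chain_iff_scan)
  then have z': "z' \<noteq> []" using syntactic_congruence_Nil[OF assms(1)] by simp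
  show ?thesis
  proof (rule half_congruentI)
    fix u v u\<^sub>0 v\<^sub>0
    assume c: "word_of (last_letter (y @ z)) @ v\<^sub>0 \<in> lt_words" "chain_in u (u\<^sub>0 @ (y @ z) @ v\<^sub>0) v"
    then have lt: "word_of (last_letter z) @ v\<^sub>0 \<in> lt_words" using z by (simp add: last_letter_append)
    have suf: "chain_in (u @ u\<^sub>0 @ y) ([] @ z @ v\<^sub>0) v"
      using chain_suffix[of u "u\<^sub>0 @ y" z v\<^sub>0 v r] c(2) assms(2,3) lt z by simp
    note zz = syntactic_congruenceD[OF assms(1) _ lt suf]
    have "chain_in u ((u\<^sub>0 @ y) @ z' @ v\<^sub>0) v"
      using chain_in_skip_end[of "z @ v\<^sub>0" u "u\<^sub>0 @ y" v] chain_in_skip_end[of "z' @ v\<^sub>0" u "u\<^sub>0 @ y" v]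
        suf zz(1) c(2) assms(2) by simp
    then show "chain_in u (u\<^sub>0 @ (y @ z') @ v\<^sub>0) v \<and>
        (u @ u\<^sub>0 @ (y @ z) @ v\<^sub>0 @ v \<in> L \<longleftrightarrow> u @ u\<^sub>0 @ (y @ z') @ v\<^sub>0 @ v \<in> L)"
      using zz(2) by simp
  qed (use assms(2) z z' syntactic_congruence_ends[OF assms(1)] in
      \<open>simp_all add: first_letter_append last_letter_append\<close>)
qed

lemma half_congruent_pop:
  assumes "(y, y') \<in> syntactic_congruence L" "(z, z') \<in> syntactic_congruence L"
    and "y \<noteq> []" "z = [] \<or> chain (Some (last y)) z r"
  shows "half_congruent L (y @ z) (y' @ z')"
proof -
  have y': "y' \<noteq> []" "last y' = last y"
    using assms(1,3) syntactic_congruence_Nil[OF assms(1)] syntactic_congruence_ends(2)[OF assms(1)]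
    by (auto simp: last_letter_def)
  have "half_congruent L (y' @ z) (y' @ z')"
    using half_congruent_pop_right[OF assms(2) y'(1), of r] y'(2) assms(4)
      syntactic_congruence_Nil[OF assms(2)] half_congruent_refl by (cases "z = []") simp_all
  then show ?thesis
    using half_congruent_pop_left[OF assms(1,3,4)] half_congruent_trans by blast
qed

lemma congruent_shift_pop:
  assumes "(y, y') \<in> syntactic_congruence L" "(z, z') \<in> syntactic_congruence L" "y \<noteq> []"
  shows "last y \<doteq> a \<Longrightarrow> z = [] \<or> chain (Some (last y)) z (Some a) \<Longrightarrow>
      (y @ z @ [a], y' @ z' @ [a]) \<in> syntactic_congruence L"
    and "z = [] \<or> chain (Some (last y)) z r \<Longrightarrow> (y @ z, y' @ z') \<in> syntactic_congruence L"
proof -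
  note sym = assms(1,2)[THEN syntactic_congruence_sym]
  have y': "y' \<noteq> []" "last y' = last y"
    using assms(1,3) syntactic_congruence_Nil[OF assms(1)] syntactic_congruence_ends(2)[OF assms(1)]
    by (auto simp: last_letter_def)
  \<comment> \<open>The hypotheses pass to \<open>y'\<close> and \<open>z'\<close>, which gives the
    half in the opposite direction.\<close>
  have z': "z' = [] \<or> chain (Some (last y')) z' r" if "z = [] \<or> chain (Some (last y)) z r" for r
    using that assms(2) y'(2) chain_congruent syntactic_congruence_Nil by metis
  show "(y @ z @ [a], y' @ z' @ [a]) \<in> syntactic_congruence L"
    if "last y \<doteq> a" "z = [] \<or> chain (Some (last y)) z (Some a)"
    using half_congruent_shift[OF assms that] half_congruent_shift[OF sym y'(1) _ z'[OF that(2)]]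
      that(1) y'(2) by (simp add: syntactic_congruence_iff_half)
  show "(y @ z, y' @ z') \<in> syntactic_congruence L" if "z = [] \<or> chain (Some (last y)) z r"
    using half_congruent_pop[OF assms that] half_congruent_pop[OF sym y'(1) z'[OF that]]
    by (simp add: syntactic_congruence_iff_half)
qed

section \<open>Construction and correctness of the automaton\<close>

definition representative :: "'a list set \<Rightarrow> 'a list \<Rightarrow> 'a list" where
  "representative L x = (SOME y. y \<in> syntactic_congruence L `` {x})"

lemma congruent_representative: "(x, representative L x) \<in> syntactic_congruence L"
  unfolding representative_def
  using someI[of "\<lambda>y. y \<in> syntactic_congruence L `` {x}" x] syntactic_congruence_refl[of x L] by simp

lemma congruent_representativeI:
  "(x, y) \<in> syntactic_congruence L \<Longrightarrow> (x, representative L y) \<in> syntactic_congruence L"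
  using congruent_representative[of y L] equiv_syntactic_congruence[of L]
  by (meson equiv_def transD)

lemma representative_Nil [simp]: "representative L [] = []"
  using syntactic_congruence_Nil[OF congruent_representative] by blast

text \<open>The choice is made from the class itself, so each class contributes one
  representative.\<close>

lemma finite_representatives:
  assumes "finite (UNIV // syntactic_congruence L)"
  shows "finite (range (representative L))"
proof (rule finite_subset)
  show "range (representative L) \<subseteq> (\<lambda>X. SOME y. y \<in> X) ` (UNIV // syntactic_congruence L)"
    unfolding representative_def by (blast intro: quotientI)
qed (use assms in simp)

text \<open>
  In a state \<open>(y, z)\<close>, \<open>y\<close> represents the text from the letter below the topmost handle
  (exclusively) to the last letter of that handle, and \<open>z\<close> the chain read and popped since. A push
  starts a new handle, whose text \<open>z a\<close> takes over \<open>z\<close>, and keeps \<open>y\<close> on the stack.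
\<close>

definition syntactic_opa :: "'a list set \<Rightarrow> ('a, 'a list \<times> 'a list) opa" where
  "syntactic_opa L = (let R = range (representative L) in
     \<lparr> states = R \<times> R,
       initial = {([], [])},
       accepting = {[]} \<times> (R \<inter> L),
       push_trans = {((y, z), a, (representative L (z @ [a]), [])) | y z a. y \<in> R \<and> z \<in> R},
       shift_trans = {((y, z), a, (representative L (y @ z @ [a]), [])) | y z a. y \<in> R \<and> z \<in> R},
       pop_trans = {((y', z'), (y, z), (y, representative L (y' @ z'))) | y z y' z'.
          y \<in> R \<and> z \<in> R \<and> y' \<in> R \<and> z' \<in> R} \<rparr>)"

lemma Nil_representative: "[] \<in> range (representative L)"
  by (rule range_eqI[of _ _ "[]"]) simp

lemma opa_syntactic_opa:
  assumes "finite (UNIV // syntactic_congruence L)"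
  shows "opa (syntactic_opa L)"
  using finite_representatives[OF assms] Nil_representative[of L]
  by (auto simp: opa_def syntactic_opa_def Let_def)

text \<open>The stack invariant: the text splits into one unfinished handle per entry. The class of
  a handle is held one entry further up, for the topmost handle in the state; so the entry of
  \<open>x\<close> holds the \<open>y\<^sub>0\<close> of the handle below.\<close>

inductive tracks :: "'a list set \<Rightarrow> 'a list \<Rightarrow> ('a \<times> 'a list \<times> 'a list) list \<Rightarrow> 'a list \<Rightarrow> bool"
  for L where
  "tracks L [] [] []"
| "\<lbrakk> tracks L p \<theta> y\<^sub>0; opens chain (top_letter None (map fst \<theta>)) x;
     (x, y) \<in> syntactic_congruence L \<rbrakk> \<Longrightarrow> tracks L (p @ x) ((last x, (y\<^sub>0, z\<^sub>0)) # \<theta>) y"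

definition tracks_conf where
  "tracks_conf L w\<^sub>0 = (\<lambda>((y, z), w, \<theta>). \<exists>p x. w\<^sub>0 = p @ x @ w \<and> tracks L p \<theta> y \<and>
     (x = [] \<or> chain (top_letter None (map fst \<theta>)) x (first_letter w)) \<and>
     (x, z) \<in> syntactic_congruence L)"

lemma tracks_confI:
  assumes "w\<^sub>0 = p @ x @ w" "tracks L p \<theta> y"
    and "x = [] \<or> chain (top_letter None (map fst \<theta>)) x (first_letter w)"
    and "(x, z) \<in> syntactic_congruence L"
  shows "tracks_conf L w\<^sub>0 ((y, z), w, \<theta>)"
  using assms unfolding tracks_conf_def prod.case by blast

text \<open>The three moves correspond to the three closure properties, with
  \<open>opens.start\<close>, \<open>opens.extend\<close> and \<open>chain_closeI\<close> on the
  side of chains.\<close>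

lemma tracks_conf_step:
  assumes "step (syntactic_opa L) c c'" "tracks_conf L w\<^sub>0 c"
  shows "tracks_conf L w\<^sub>0 c'"
  using assms(1)
proof cases
  case (push \<theta> a s t w)
  obtain y z where s: "s = (y, z)" by (cases s)
  have t: "t = (representative L (z @ [a]), [])"
    using push(4) by (auto simp: s syntactic_opa_def Let_def)
  obtain p x where h: "w\<^sub>0 = p @ x @ a # w" "tracks L p \<theta> y"
    "x = [] \<or> chain (top_letter None (map fst \<theta>)) x (Some a)" "(x, z) \<in> syntactic_congruence L"
    using assms(2) push(1) by (auto simp: tracks_conf_def s)
  have "top_letter None (map fst \<theta>) \<lhd>\<^sub>\<epsilon> Some a"
    using push(3) by (cases \<theta>) (auto simp: top_letter_def)
  then have op: "opens chain (top_letter None (map fst \<theta>)) (x @ [a])"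
    using h(3) by (rule opens.start)
  have "tracks L (p @ x @ [a]) ((last (x @ [a]), (y, z)) # \<theta>) (representative L (z @ [a]))"
    by (rule tracks.intros(2)[OF h(2) op congruent_representativeI[OF congruent_push[OF h(4,3)]]])
  from tracks_confI[OF _ this _ syntactic_congruence_refl[of "[]"]] show ?thesis
    using h(1) push(2) by (simp add: s t)
next
  case (shift b a s t w q \<theta>)
  obtain y z where s: "s = (y, z)" by (cases s)
  have t: "t = (representative L (y @ z @ [a]), [])"
    using shift(4) by (auto simp: s syntactic_opa_def Let_def)
  obtain p' x where h: "w\<^sub>0 = p' @ x @ a # w" "tracks L p' ((b, q) # \<theta>) y"
    "x = [] \<or> chain (Some b) x (Some a)" "(x, z) \<in> syntactic_congruence L"
    using assms(2) shift(1) by (auto simp: tracks_conf_def s top_letter_def)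
  obtain p x' y\<^sub>0 z\<^sub>0 where g: "p' = p @ x'" "tracks L p \<theta> y\<^sub>0" "q = (y\<^sub>0, z\<^sub>0)"
    "opens chain (top_letter None (map fst \<theta>)) x'" "(x', y) \<in> syntactic_congruence L" "last x' = b"
    using h(2) by (auto elim: tracks.cases)
  have op: "opens chain (top_letter None (map fst \<theta>)) (x' @ x @ [a])"
    using g(4,6) shift(3) h(3) by (intro opens.extend) auto
  have "(x' @ x @ [a], y @ z @ [a]) \<in> syntactic_congruence L"
    using congruent_shift_pop(1)[OF g(5) h(4) opens_not_Nil[OF g(4)]] shift(3) h(3) g(6) by simp
  then have "tracks L (p @ x' @ x @ [a]) ((last (x' @ x @ [a]), (y\<^sub>0, z\<^sub>0)) # \<theta>)
      (representative L (y @ z @ [a]))"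
    by (intro tracks.intros(2)[OF g(2) op] congruent_representativeI)
  from tracks_confI[OF _ this _ syntactic_congruence_refl[of "[]"]] show ?thesis
    using h(1) g(1,3,6) shift(2) by (simp add: t)
next
  case (pop b w s q t \<theta>)
  obtain y z where s: "s = (y, z)" by (cases s)
  obtain p' x where h: "w\<^sub>0 = p' @ x @ w" "tracks L p' ((b, q) # \<theta>) y"
    "x = [] \<or> chain (Some b) x (first_letter w)" "(x, z) \<in> syntactic_congruence L"
    using assms(2) pop(1) by (auto simp: tracks_conf_def s top_letter_def)
  obtain p x' y\<^sub>0 z\<^sub>0 where g: "p' = p @ x'" "tracks L p \<theta> y\<^sub>0" "q = (y\<^sub>0, z\<^sub>0)"
    "opens chain (top_letter None (map fst \<theta>)) x'" "(x', y) \<in> syntactic_congruence L" "last x' = b"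
    using h(2) by (auto elim: tracks.cases)
  have t: "t = (y\<^sub>0, representative L (y @ z))"
    using pop(4) by (auto simp: s g(3) syntactic_opa_def Let_def)
  have "chain (top_letter None (map fst \<theta>)) (x' @ x) (first_letter w)"
    using chain_closeI[OF g(4)] pop(3) h(3) g(6) by simp
  moreover have c: "(x' @ x, representative L (y @ z)) \<in> syntactic_congruence L"
    using congruent_shift_pop(2)[OF g(5) h(4) opens_not_Nil[OF g(4)]] h(3) g(6)
    by (intro congruent_representativeI) simp
  ultimately show ?thesis
    using h(1) g(1) pop(2) tracks_confI[OF _ g(2) _ c] by (simp add: t)
qed

lemma tracks_empty_stack: "tracks L p [] y \<Longrightarrow> p = [] \<and> y = []"
  by (auto elim: tracks.cases)

text \<open>With an empty stack the invariant leaves only the closed part \<open>x\<close>, which is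
  all of \<open>w\<close>.\<close>

lemma syntactic_opa_run:
  assumes "(step (syntactic_opa L))\<^sup>*\<^sup>* (([], []), w, []) ((y, z), [], [])"
  shows "y = [] \<and> (w, z) \<in> syntactic_congruence L"
proof -
  have "tracks_conf L w (([], []), w, [])"
    using tracks.intros(1)[of L] syntactic_congruence_refl[of "[]" L]
    by (auto simp: tracks_conf_def)
  with assms have "tracks_conf L w ((y, z), [], [])"
    by (induction rule: rtranclp_induct) (auto intro: tracks_conf_step)
  then show ?thesis by (auto simp: tracks_conf_def dest!: tracks_empty_stack)
qed

lemma complete_syntactic_opa: "complete_opa (syntactic_opa L)"
  by (auto simp: complete_opa_def syntactic_opa_def Let_def)

lemma finishes_exists:
  assumes "opa M" "complete_opa M" "s \<in> states M"
  shows "\<exists>t \<in> states M. finishes M w s [] t"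
proof (cases "w = []")
  case True
  then show ?thesis using assms(3) by (auto simp: finishes_def)
next
  case False
  then obtain t s' \<theta> where "opa_scan M (\<lambda>_. True) s [] w s' \<theta>" "opa_drain M None s' \<theta> t"
    using chain_summary[OF assms chain_None_None] unfolding summary_def above_None by blast
  then show ?thesis
    using opa_scan_states[of M _ s "[]" w s' \<theta>] opa_drain_states[of M None s' \<theta> t] assms
    by (auto simp: finishes_def)
qed

text \<open>By completeness some run over \<open>w\<close> empties the stack, and every such run
  ends in \<open>([], z)\<close> with \<open>z\<close> congruent to \<open>w\<close>. As
  \<open>L\<close> is a union of classes, acceptance amounts to \<open>w \<in> L\<close>.\<close>

lemma syntactic_opa_language:
  assumes "finite (UNIV // syntactic_congruence L)"
  shows "opa_language (syntactic_opa L) = L"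
proof (intro equalityI subsetI)
  fix w assume "w \<in> opa_language (syntactic_opa L)"
  then obtain z where "z \<in> L" "(step (syntactic_opa L))\<^sup>*\<^sup>* (([], []), w, []) (([], z), [], [])"
    by (auto simp: opa_language_def syntactic_opa_def Let_def)
  then show "w \<in> L" using syntactic_opa_run syntactic_congruence_member by blast
next
  fix w assume w: "w \<in> L"
  have "([], []) \<in> states (syntactic_opa L)"
    using Nil_representative by (simp add: syntactic_opa_def)
  then obtain y z where t: "(y, z) \<in> states (syntactic_opa L)"
    "finishes (syntactic_opa L) w ([], []) [] (y, z)"
    using finishes_exists[OF opa_syntactic_opa[OF assms] complete_syntactic_opa] by fast
  then have "y = []" "(w, z) \<in> syntactic_congruence L"
    using syntactic_opa_run[of L w y z] by (simp_all add: finishes_steps)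
  moreover from this(2) have "z \<in> L" using syntactic_congruence_member w by blast
  ultimately show "w \<in> opa_language (syntactic_opa L)"
    using t by (auto simp: opa_language_iff syntactic_opa_def Let_def)
qed

theorem op_language_iff_finite_index:
  "op_language L \<longleftrightarrow> finite (UNIV // syntactic_congruence L)"
proof
  assume "op_language L"
  then show "finite (UNIV // syntactic_congruence L)"
    unfolding op_language_def using finite_index_opa_language by blast
next
  assume fin: "finite (UNIV // syntactic_congruence L)"
  show "op_language L"
    using op_languageI[OF opa_syntactic_opa[OF fin]] syntactic_opa_language[OF fin] by simp
qed

end

theorem theorem24:
  fixes lt gt eq :: "'a::finite \<Rightarrow> 'a \<Rightarrow> bool"
    and L :: "'a list set"
  assumes "op_alphabet lt gt eq"
  shows "op_alphabet.op_language lt gt eq L \<longleftrightarrow>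
    finite (UNIV // op_alphabet.syntactic_congruence lt gt eq L)"
  by (rule op_alphabet.op_language_iff_finite_index[OF assms])

end
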